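(* Let $F$ be a continuous weight preserving covariant functor from the category of compact spaces and continuous maps to itself. If $K$ is a Valdivia compact space, then $F(K)$ is Valdivia compact.
   Context: All spaces are Hausdorff. The functor $F$ is continuous if it preserves inverse limits: whenever a compact space $X$ with projections $p_s$ is the limit of an inverse system of compact spaces indexed by a directed poset (with surjective bonding maps), $F(X)$ with the maps $F(p_s)$ is the limit of the image system. $F$ is weight preserving if $\mathrm{w}(F(K))\le\mathrm{w}(K)$ for every compact space $K$, where $\mathrm{w}$ denotes the weight (least cardinality of an open base). For a set $T$, $\Sigma(T)=\{x\in[0,1]^T: \{\alpha\in T: x(\alpha)\neq 0\}\text{ is countable}\}$. A compact space $X$ is Valdivia compact if for some set $T$ there is an embedding $h\colon X\to[0,1]^T$ with $h[X]=\operatorname{cl}(\Sigma(T)\cap h[X])$, the closure being taken in $[0,1]^T$. *)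

theory Defs
  imports "HOL-Analysis.Analysis"
begin

unbundle cardinal_syntax

abbreviation compact_Hausdorff :: "'a topology \<Rightarrow> bool" where
  "compact_Hausdorff X \<equiv> compact_space X \<and> Hausdorff_space X"


section \<open>Weight\<close>

definition open_base :: "'a topology \<Rightarrow> 'a set set \<Rightarrow> bool" where
  "open_base X B \<longleftrightarrow> (\<forall>V\<in>B. openin X V) \<and>
     (\<forall>U x. openin X U \<and> x \<in> U \<longrightarrow> (\<exists>V\<in>B. x \<in> V \<and> V \<subseteq> U))"

definition weight :: "'a topology \<Rightarrow> 'a set rel" where
  "weight X = |SOME B. open_base X B \<and> (\<forall>C. open_base X C \<longrightarrow> |B| \<le>o |C| )|"

lemma weight_least:
  "\<exists>B. open_base X B \<and> weight X = |B| \<and> (\<forall>C. open_base X C \<longrightarrow> |B| \<le>o |C| )"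
proof -
  have "open_base X {U. openin X U}"
    by (auto simp: open_base_def)
  then have "\<exists>r\<in>{|B| | B. open_base X B}. \<forall>r'\<in>{|B| | B. open_base X B}. r \<le>o r'"
    by (intro exists_minim_Card_order) (auto simp: card_of_Card_order)
  then have "\<exists>B. open_base X B \<and> (\<forall>C. open_base X C \<longrightarrow> |B| \<le>o |C| )"
    by blast
  from someI_ex[OF this] show ?thesis
    unfolding weight_def by blast
qed


section \<open>Inverse systems and their limits\<close>

text \<open>\<^term>\<open>(s, t) \<in> r\<close> stands for \<open>s \<le> t\<close>, and \<^term>\<open>\<pi> s t\<close> is the bonding map from
  \<^term>\<open>S t\<close> to \<^term>\<open>S s\<close>.\<close>

definition directed_poset :: "'i set \<Rightarrow> 'i rel \<Rightarrow> bool" where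
  "directed_poset I r \<longleftrightarrow> partial_order_on I r \<and> I \<noteq> {} \<and>
     (\<forall>s\<in>I. \<forall>t\<in>I. \<exists>u\<in>I. (s, u) \<in> r \<and> (t, u) \<in> r)"

definition inverse_system ::
  "'i set \<Rightarrow> 'i rel \<Rightarrow> ('i \<Rightarrow> 'a topology) \<Rightarrow> ('i \<Rightarrow> 'i \<Rightarrow> 'a \<Rightarrow> 'a) \<Rightarrow> bool" where
  "inverse_system I r S \<pi> \<longleftrightarrow> directed_poset I r \<and>
     (\<forall>(s, t)\<in>r. continuous_map (S t) (S s) (\<pi> s t)) \<and>
     (\<forall>s\<in>I. \<forall>x\<in>topspace (S s). \<pi> s s x = x) \<and>
     (\<forall>s t u. (s, t) \<in> r \<and> (t, u) \<in> r \<longrightarrow> (\<forall>x\<in>topspace (S u). \<pi> s t (\<pi> t u x) = \<pi> s u x))"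

definition threads ::
  "'i set \<Rightarrow> 'i rel \<Rightarrow> ('i \<Rightarrow> 'a topology) \<Rightarrow> ('i \<Rightarrow> 'i \<Rightarrow> 'a \<Rightarrow> 'a) \<Rightarrow> ('i \<Rightarrow> 'a) set" where
  "threads I r S \<pi> = {z \<in> topspace (product_topology S I). \<forall>(s, t)\<in>r. \<pi> s t (z t) = z s}"

definition is_inverse_limit ::
  "'i set \<Rightarrow> 'i rel \<Rightarrow> ('i \<Rightarrow> 'a topology) \<Rightarrow> ('i \<Rightarrow> 'i \<Rightarrow> 'a \<Rightarrow> 'a) \<Rightarrow>
     'a topology \<Rightarrow> ('i \<Rightarrow> 'a \<Rightarrow> 'a) \<Rightarrow> bool" where
  "is_inverse_limit I r S \<pi> X p \<longleftrightarrow>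
     homeomorphic_map X (subtopology (product_topology S I) (threads I r S \<pi>))
       (\<lambda>x. \<lambda>s\<in>I. p s x)"


section \<open>Functors on compact spaces\<close>

text \<open>Since HOL cannot quantify over types, ``all compact spaces'' are the compact Hausdorff
  topologies carried by subsets of an arbitrary type (of arbitrarily large cardinality). No
  infinite type is closed under such operations as \<open>X \<mapsto> {closed subsets of X}\<close>, so the values
  of a functor are allowed to live on a second, independent type \<open>'b\<close>; endofunctors are the
  instance \<open>'b = 'a\<close>. A morphism from \<open>X\<close> to \<open>Y\<close> is a continuous map up to equality on
  \<open>topspace X\<close>, whence the third condition below.\<close>

definition compact_functor ::
  "('a topology \<Rightarrow> 'b topology) \<Rightarrow> ('a topology \<Rightarrow> 'a topology \<Rightarrow> ('a \<Rightarrow> 'a) \<Rightarrow> 'b \<Rightarrow> 'b) \<Rightarrow> bool" where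
  "compact_functor Fo Fm \<longleftrightarrow>
     (\<forall>X. compact_Hausdorff X \<longrightarrow> compact_Hausdorff (Fo X)) \<and>
     (\<forall>X Y f. compact_Hausdorff X \<and> compact_Hausdorff Y \<and> continuous_map X Y f \<longrightarrow>
        continuous_map (Fo X) (Fo Y) (Fm X Y f)) \<and>
     (\<forall>X Y f g. compact_Hausdorff X \<and> compact_Hausdorff Y \<and>
        continuous_map X Y f \<and> continuous_map X Y g \<and> (\<forall>x\<in>topspace X. f x = g x) \<longrightarrow>
        (\<forall>a\<in>topspace (Fo X). Fm X Y f a = Fm X Y g a)) \<and>
     (\<forall>X. compact_Hausdorff X \<longrightarrow> (\<forall>a\<in>topspace (Fo X). Fm X X id a = a)) \<and>
     (\<forall>X Y Z f g. compact_Hausdorff X \<and> compact_Hausdorff Y \<and> compact_Hausdorff Z \<and>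
        continuous_map X Y f \<and> continuous_map Y Z g \<longrightarrow>
        (\<forall>a\<in>topspace (Fo X). Fm X Z (g \<circ> f) a = Fm Y Z g (Fm X Y f a)))"

definition preserves_limits_over ::
  "'i itself \<Rightarrow> ('a topology \<Rightarrow> 'b topology) \<Rightarrow>
     ('a topology \<Rightarrow> 'a topology \<Rightarrow> ('a \<Rightarrow> 'a) \<Rightarrow> 'b \<Rightarrow> 'b) \<Rightarrow> bool" where
  "preserves_limits_over _ Fo Fm \<longleftrightarrow>
     (\<forall>(I :: 'i set) r S \<pi> X p.
        inverse_system I r S \<pi> \<and> (\<forall>s\<in>I. compact_Hausdorff (S s)) \<and>
        (\<forall>(s, t)\<in>r. \<pi> s t ` topspace (S t) = topspace (S s)) \<and>
        compact_Hausdorff X \<and> is_inverse_limit I r S \<pi> X p \<longrightarrow>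
        is_inverse_limit I r (\<lambda>s. Fo (S s)) (\<lambda>s t. Fm (S t) (S s) (\<pi> s t))
          (Fo X) (\<lambda>s. Fm X (S s) (p s)))"

text \<open>Index posets on the type \<open>('a \<times> 'a) set\<close> account for all index posets, since a system can
  be reindexed by the kernels of its limit projections: see \<open>continuous_functor_any_index\<close>.\<close>

definition continuous_functor ::
  "('a topology \<Rightarrow> 'b topology) \<Rightarrow> ('a topology \<Rightarrow> 'a topology \<Rightarrow> ('a \<Rightarrow> 'a) \<Rightarrow> 'b \<Rightarrow> 'b) \<Rightarrow> bool" where
  "continuous_functor Fo Fm \<longleftrightarrow> preserves_limits_over TYPE(('a \<times> 'a) set) Fo Fm"

definition weight_preserving :: "('a topology \<Rightarrow> 'b topology) \<Rightarrow> bool" where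
  "weight_preserving Fo \<longleftrightarrow> (\<forall>K. compact_Hausdorff K \<longrightarrow> weight (Fo K) \<le>o weight K)"


section \<open>Valdivia compact spaces\<close>

definition cube :: "'t set \<Rightarrow> ('t \<Rightarrow> real) topology" where
  "cube T = product_topology (\<lambda>_. top_of_set {0..1}) T"

definition Sigma_prod :: "'t set \<Rightarrow> ('t \<Rightarrow> real) set" where
  "Sigma_prod T = {x \<in> topspace (cube T). countable {\<alpha>\<in>T. x \<alpha> \<noteq> 0}}"

definition valdivia_embedding :: "'a topology \<Rightarrow> 't set \<Rightarrow> ('a \<Rightarrow> 't \<Rightarrow> real) \<Rightarrow> bool" where
  "valdivia_embedding X T h \<longleftrightarrow> embedding_map X (cube T) h \<and>
     h ` topspace X = cube T closure_of (Sigma_prod T \<inter> h ` topspace X)"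

text \<open>Index sets \<open>T\<close> of type \<open>('a \<Rightarrow> real) set\<close> account for all index sets, since every coordinate
  of an embedding is a real function on the space: see \<open>valdivia_compactI\<close>.\<close>

definition valdivia_compact :: "'a topology \<Rightarrow> bool" where
  "valdivia_compact X \<longleftrightarrow> compact_Hausdorff X \<and>
     (\<exists>(T :: ('a \<Rightarrow> real) set) h. valdivia_embedding X T h)"


section \<open>The index types above are large enough\<close>

lemma topspace_cube: "topspace (cube T) = (\<Pi>\<^sub>E \<alpha>\<in>T. {0..1})"
  by (simp add: cube_def)

lemma Hausdorff_cube: "Hausdorff_space (cube T)"
  unfolding cube_def by (simp add: Hausdorff_space_product_topology Hausdorff_space_subtopology)

lemma valdivia_compactI:
  fixes X :: "'a topology" and T :: "'t set"
  assumes X: "compact_Hausdorff X" and h: "valdivia_embedding X T h"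
  shows "valdivia_compact X"
proof -
  define c where "c = (\<lambda>\<alpha> (x::'a). h x \<alpha>)"
  define T' where "T' = c ` T"
  define h' where "h' = (\<lambda>x. \<lambda>f\<in>T'. f x)"
  define sel where "sel = inv_into T c"
  define \<rho> where "\<rho> = (\<lambda>(z :: 't \<Rightarrow> real). \<lambda>f\<in>T'. z (sel f))"
  have sel: "sel f \<in> T" "c (sel f) = f" if "f \<in> T'" for f
    using that by (auto simp: T'_def sel_def inv_into_into f_inv_into_f)
  have emb: "embedding_map X (cube T) h"
    and dense: "h ` topspace X = cube T closure_of (Sigma_prod T \<inter> h ` topspace X)"
    using h by (auto simp: valdivia_embedding_def)
  have conth: "continuous_map X (cube T) h"
    using emb by (meson embedding_map_def homeomorphic_imp_continuous_map continuous_map_in_subtopology)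
  have injh: "inj_on h (topspace X)"
    using emb by (meson embedding_map_def homeomorphic_map_def)
  have \<rho>h: "\<rho> (h x) = h' x" for x
  proof
    fix f show "\<rho> (h x) f = h' x f"
      using fun_cong[OF sel(2)[of f], of x] by (auto simp: \<rho>_def h'_def c_def)
  qed
  have cont\<rho>: "continuous_map (cube T) (cube T') \<rho>"
    unfolding cube_def \<rho>_def
    by (auto simp: continuous_map_componentwise intro!: continuous_map_product_projection sel(1))
  have conth': "continuous_map X (cube T') h'"
    using continuous_map_compose[OF conth cont\<rho>] by (simp add: o_def \<rho>h)
  have injh': "inj_on h' (topspace X)"
  proof (rule inj_onI)
    fix x y assume xy: "x \<in> topspace X" "y \<in> topspace X" and eq: "h' x = h' y"
    have "h x \<alpha> = h y \<alpha>" for \<alpha>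
    proof (cases "\<alpha> \<in> T")
      case True
      then have "c \<alpha> x = c \<alpha> y"
        using fun_cong[OF eq, of "c \<alpha>"] by (auto simp: h'_def T'_def)
      then show ?thesis by (simp add: c_def)
    next
      case False
      have "h x \<in> topspace (cube T)" "h y \<in> topspace (cube T)"
        using conth xy by (auto simp: continuous_map_def)
      then show ?thesis
        using False by (auto simp: topspace_cube PiE_def extensional_def)
    qed
    then show "x = y" using injh xy by (metis ext inj_onD)
  qed
  have clmap: "closed_map X (cube T') h'"
    using X conth' Hausdorff_cube by (blast intro: continuous_imp_closed_map)
  have emb': "embedding_map X (cube T') h'"
    by (rule injective_closed_imp_embedding_map[OF conth' clmap injh'])
  have cl: "closedin (cube T') (h' ` topspace X)"
    using clmap by (auto simp: closed_map_def)
  have sub: "\<rho> ` (Sigma_prod T \<inter> h ` topspace X) \<subseteq> Sigma_prod T' \<inter> h' ` topspace X"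
  proof safe
    fix x assume x: "x \<in> topspace X" and s: "h x \<in> Sigma_prod T"
    have "sel ` {f\<in>T'. h' x f \<noteq> 0} \<subseteq> {\<alpha>\<in>T. h x \<alpha> \<noteq> 0}"
    proof
      fix a assume "a \<in> sel ` {f\<in>T'. h' x f \<noteq> 0}"
      then obtain f where f: "f \<in> T'" "h' x f \<noteq> 0" "a = sel f" by blast
      then have "h x a = f x" using sel(2)[of f] by (metis c_def)
      then show "a \<in> {\<alpha>\<in>T. h x \<alpha> \<noteq> 0}" using f sel(1)[of f] by (auto simp: h'_def)
    qed
    moreover have "countable {\<alpha>\<in>T. h x \<alpha> \<noteq> 0}"
      using s by (simp add: Sigma_prod_def)
    ultimately have "countable (sel ` {f\<in>T'. h' x f \<noteq> 0})"
      by (rule countable_subset)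
    moreover have "inj_on sel {f\<in>T'. h' x f \<noteq> 0}"
      by (rule inj_on_inverseI[of _ c]) (auto simp: sel)
    ultimately have "countable {f\<in>T'. h' x f \<noteq> 0}"
      by (simp add: countable_image_inj_eq)
    moreover have "h' x \<in> topspace (cube T')"
      using conth' x by (auto simp: continuous_map_def)
    ultimately show "\<rho> (h x) \<in> Sigma_prod T'"
      by (simp add: \<rho>h Sigma_prod_def)
    show "\<rho> (h x) \<in> h' ` topspace X" using x by (simp add: \<rho>h)
  qed
  have "h' ` topspace X = \<rho> ` (h ` topspace X)"
    by (simp add: image_image \<rho>h)
  also have "\<dots> = \<rho> ` (cube T closure_of (Sigma_prod T \<inter> h ` topspace X))"
    using dense by simp
  also have "\<dots> \<subseteq> cube T' closure_of (\<rho> ` (Sigma_prod T \<inter> h ` topspace X))"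
    by (rule continuous_map_image_closure_subset[OF cont\<rho>])
  also have "\<dots> \<subseteq> cube T' closure_of (Sigma_prod T' \<inter> h' ` topspace X)"
    by (rule closure_of_mono[OF sub])
  finally have "h' ` topspace X = cube T' closure_of (Sigma_prod T' \<inter> h' ` topspace X)"
    using closure_of_minimal[OF _ cl, of "Sigma_prod T' \<inter> h' ` topspace X"] by blast
  then show ?thesis
    using X emb' unfolding valdivia_compact_def valdivia_embedding_def by blast
qed

lemma is_inverse_limitD:
  assumes "is_inverse_limit I r S \<pi> X p"
  shows "s \<in> I \<Longrightarrow> continuous_map X (S s) (p s)"
    and "x \<in> topspace X \<Longrightarrow> (s, t) \<in> r \<Longrightarrow> s \<in> I \<Longrightarrow> t \<in> I \<Longrightarrow> \<pi> s t (p t x) = p s x"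
    and "x \<in> topspace X \<Longrightarrow> y \<in> topspace X \<Longrightarrow> (\<And>s. s \<in> I \<Longrightarrow> p s x = p s y) \<Longrightarrow> x = y"
    and "(\<And>s. s \<in> I \<Longrightarrow> z s \<in> topspace (S s)) \<Longrightarrow> r \<subseteq> I \<times> I \<Longrightarrow>
           (\<And>s t. (s, t) \<in> r \<Longrightarrow> \<pi> s t (z t) = z s) \<Longrightarrow>
           \<exists>x\<in>topspace X. \<forall>s\<in>I. p s x = z s"
proof -
  let ?e = "\<lambda>x. \<lambda>s\<in>I. p s x"
  have c: "continuous_map X (product_topology S I) ?e"
    and im: "?e ` topspace X = threads I r S \<pi>" and inj: "inj_on ?e (topspace X)"
    using homeomorphic_imp_continuous_map[OF assms[unfolded is_inverse_limit_def]]
      homeomorphic_imp_surjective_map[OF assms[unfolded is_inverse_limit_def]]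
      homeomorphic_imp_injective_map[OF assms[unfolded is_inverse_limit_def]]
    by (auto simp: continuous_map_in_subtopology threads_def)
  show "continuous_map X (S s) (p s)" if "s \<in> I"
    using c that by (simp add: continuous_map_componentwise)
  show "\<pi> s t (p t x) = p s x" if "x \<in> topspace X" "(s, t) \<in> r" "s \<in> I" "t \<in> I"
  proof -
    have "?e x \<in> threads I r S \<pi>" using im that by blast
    then show ?thesis using that by (fastforce simp: threads_def)
  qed
  show "x = y" if "x \<in> topspace X" "y \<in> topspace X" "\<And>s. s \<in> I \<Longrightarrow> p s x = p s y"
    by (rule inj_onD[OF inj]) (use that in auto)
  show "\<exists>x\<in>topspace X. \<forall>s\<in>I. p s x = z s"
    if z: "\<And>s. s \<in> I \<Longrightarrow> z s \<in> topspace (S s)" "r \<subseteq> I \<times> I"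
      "\<And>s t. (s, t) \<in> r \<Longrightarrow> \<pi> s t (z t) = z s"
  proof -
    have "restrict z I \<in> threads I r S \<pi>"
      using z by (auto simp: threads_def subset_iff)
    then obtain x where "x \<in> topspace X" "restrict z I = ?e x" using im by blast
    then show ?thesis by (metis restrict_apply')
  qed
qed

lemma is_inverse_limitI:
  assumes X: "compact_space X" and S: "\<And>s. s \<in> I \<Longrightarrow> Hausdorff_space (S s)"
    and r: "r \<subseteq> I \<times> I"
    and cont: "\<And>s. s \<in> I \<Longrightarrow> continuous_map X (S s) (p s)"
    and comm: "\<And>x s t. x \<in> topspace X \<Longrightarrow> (s, t) \<in> r \<Longrightarrow> \<pi> s t (p t x) = p s x"
    and inj: "\<And>x y. x \<in> topspace X \<Longrightarrow> y \<in> topspace X \<Longrightarrow> (\<And>s. s \<in> I \<Longrightarrow> p s x = p s y) \<Longrightarrow> x = y"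
    and surj: "\<And>z. (\<And>s. s \<in> I \<Longrightarrow> z s \<in> topspace (S s)) \<Longrightarrow>
           (\<And>s t. (s, t) \<in> r \<Longrightarrow> \<pi> s t (z t) = z s) \<Longrightarrow> \<exists>x\<in>topspace X. \<forall>s\<in>I. p s x = z s"
  shows "is_inverse_limit I r S \<pi> X p"
proof -
  let ?e = "\<lambda>x. \<lambda>s\<in>I. p s x"
  let ?P = "subtopology (product_topology S I) (threads I r S \<pi>)"
  have c: "continuous_map X (product_topology S I) ?e"
    using cont by (auto simp: continuous_map_componentwise)
  have sub: "?e ` topspace X \<subseteq> threads I r S \<pi>"
  proof safe
    fix x assume x: "x \<in> topspace X"
    have "?e x \<in> topspace (product_topology S I)"
      using continuous_map_image_subset_topspace[OF c] x by blast
    moreover have "\<pi> s t (?e x t) = ?e x s" if "(s, t) \<in> r" for s t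
      using comm[OF x that] r that by auto
    ultimately show "?e x \<in> threads I r S \<pi>" unfolding threads_def by blast
  qed
  have "threads I r S \<pi> \<subseteq> ?e ` topspace X"
  proof
    fix z assume z: "z \<in> threads I r S \<pi>"
    then have "\<exists>x\<in>topspace X. \<forall>s\<in>I. p s x = z s"
      by (intro surj) (auto simp: threads_def)
    then obtain x where x: "x \<in> topspace X" "\<And>s. s \<in> I \<Longrightarrow> p s x = z s" by blast
    have "z = ?e x"
      using z x(2) by (intro extensionalityI[of z I]) (auto simp: threads_def PiE_def)
    then show "z \<in> ?e ` topspace X" using x(1) by blast
  qed
  with sub have im: "?e ` topspace X = threads I r S \<pi>" by blast
  have tp: "topspace ?P = threads I r S \<pi>" by (auto simp: threads_def)
  have c': "continuous_map X ?P ?e"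
    using c sub by (auto simp: continuous_map_in_subtopology)
  have "Hausdorff_space ?P"
    using S by (intro Hausdorff_space_subtopology) (auto simp: Hausdorff_space_product_topology)
  then have "closed_map X ?P ?e"
    using X c' by (blast intro: continuous_imp_closed_map)
  moreover have "inj_on ?e (topspace X)"
  proof (rule inj_onI)
    fix x y assume xy: "x \<in> topspace X" "y \<in> topspace X" and eq: "?e x = ?e y"
    show "x = y"
      by (rule inj[OF xy]) (use fun_cong[OF eq] in \<open>metis restrict_apply'\<close>)
  qed
  ultimately show ?thesis
    unfolding is_inverse_limit_def
    using c' im tp by (intro bijective_closed_imp_homeomorphic_map) auto
qed

lemma directed_poset_finite_ub:
  assumes "directed_poset I r" "finite A" "A \<subseteq> I"
  shows "\<exists>u\<in>I. \<forall>s\<in>A. (s, u) \<in> r"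
  using assms(2,3)
proof (induction A)
  case empty
  then show ?case using assms(1) by (auto simp: directed_poset_def)
next
  case (insert a A)
  then obtain u where u: "u \<in> I" "\<forall>s\<in>A. (s, u) \<in> r" by auto
  obtain v where v: "v \<in> I" "(a, v) \<in> r" "(u, v) \<in> r"
    using assms(1) insert.prems u(1) unfolding directed_poset_def by (metis insert_subset)
  have "trans r" using assms(1) by (simp add: directed_poset_def partial_order_on_def preorder_on_def)
  then show ?case using u v by (metis insert_iff transD)
qed

lemma inverse_limit_projection_surj:
  fixes I :: "'i set" and S :: "'i \<Rightarrow> 'a topology"
  assumes sys: "inverse_system I r S \<pi>"
    and comp: "\<And>s. s \<in> I \<Longrightarrow> compact_Hausdorff (S s)"
    and surj: "\<And>s t. (s, t) \<in> r \<Longrightarrow> \<pi> s t ` topspace (S t) = topspace (S s)"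
    and lim: "is_inverse_limit I r S \<pi> X p"
    and s: "s \<in> I"
  shows "p s ` topspace X = topspace (S s)"
proof
  show "p s ` topspace X \<subseteq> topspace (S s)"
    using is_inverse_limitD(1)[OF lim s] by (auto simp: continuous_map_def)
  show "topspace (S s) \<subseteq> p s ` topspace X"
  proof
    fix a assume a: "a \<in> topspace (S s)"
    have dir: "directed_poset I r" using sys by (simp add: inverse_system_def)
    then have rI: "r \<subseteq> I \<times> I" and rtrans: "trans r" and rrefl: "\<And>t. t \<in> I \<Longrightarrow> (t, t) \<in> r"
      by (auto simp: directed_poset_def partial_order_on_def preorder_on_def refl_on_def)
    have ub: "\<exists>u\<in>I. (t, u) \<in> r \<and> (t', u) \<in> r" if "t \<in> I" "t' \<in> I" for t t'
      using dir that by (auto simp: directed_poset_def)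
    have cont: "continuous_map (S t) (S u) (\<pi> u t)" if "(u, t) \<in> r" for u t
      using sys that by (auto simp: inverse_system_def)
    have comp': "\<pi> u t (\<pi> t v x) = \<pi> u v x"
      if "(u, t) \<in> r" "(t, v) \<in> r" "x \<in> topspace (S v)" for u t v x
      using sys that by (auto simp: inverse_system_def)
    have ne: "topspace (S t) \<noteq> {}" if t: "t \<in> I" for t
    proof -
      obtain v where v: "(s, v) \<in> r" "(t, v) \<in> r" using ub s t by blast
      then have "topspace (S v) \<noteq> {}" using surj[OF v(1)] a by auto
      then show ?thesis using surj[OF v(2)] by auto
    qed
    let ?P = "product_topology S I"
    define D where "D t = {z \<in> topspace ?P. z s = a} \<inter>
        (\<Inter>u\<in>{u. (u, t) \<in> r}. {z \<in> topspace ?P. \<pi> u t (z t) = z u})" for t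
    have comP: "compact_space ?P"
      using comp by (simp add: compact_space_product_topology)
    have clD: "closedin ?P (D t)" if t: "t \<in> I" for t
    proof -
      have "closedin ?P {z \<in> topspace ?P. z s = a}"
        using comp s a
        by (intro closedin_continuous_maps_eq[where Y="S s"])
           (auto intro: continuous_map_product_projection)
      moreover have "closedin ?P {z \<in> topspace ?P. \<pi> u t (z t) = z u}" if "(u, t) \<in> r" for u
        using comp that rI
        by (intro closedin_continuous_maps_eq[where Y="S u"])
           (auto intro: continuous_map_product_projection
              continuous_map_compose[OF continuous_map_product_projection[OF t] cont, unfolded o_def])
      ultimately show ?thesis
        unfolding D_def using rrefl[OF t] by (intro closedin_Int closedin_Inter) auto
    qed
    have neD: "D t \<noteq> {}" if t: "(s, t) \<in> r" for t
    proof -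
      have tI: "t \<in> I" using t rI by auto
      obtain y where y: "y \<in> topspace (S t)" "\<pi> s t y = a" 
        using a surj[OF t] by (metis imageE)
      define z where "z = (\<lambda>u\<in>I. if (u, t) \<in> r then \<pi> u t y else SOME w. w \<in> topspace (S u))"
      have "z u \<in> topspace (S u)" if "u \<in> I" for u
      proof (cases "(u, t) \<in> r")
        case True
        then show ?thesis using surj[OF True] y(1) that by (auto simp: z_def)
      next
        case False
        then show ?thesis using ne[OF that] that by (simp add: z_def some_in_eq)
      qed
      then have "z \<in> topspace ?P" by (auto simp: z_def)
      moreover have "z s = a" using s t y by (simp add: z_def)
      moreover have "\<pi> u t (z t) = z u" if "(u, t) \<in> r" for u
        using that rI tI y(1) rrefl[OF tI] comp'[OF that rrefl[OF tI] y(1)]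
        by (auto simp: z_def)
      ultimately have "z \<in> D t" by (auto simp: D_def)
      then show ?thesis by blast
    qed
    have mono: "D v \<subseteq> D t" if tv: "(t, v) \<in> r" for t v
    proof
      fix z assume z: "z \<in> D v"
      have zP: "z \<in> topspace ?P" "z s = a" using z by (auto simp: D_def)
      have zv: "z v \<in> topspace (S v)" using zP tv rI by (auto simp: PiE_def)
      have e: "\<pi> u v (z v) = z u" if "(u, v) \<in> r" for u using z that by (auto simp: D_def)
      have "\<pi> u t (z t) = z u" if "(u, t) \<in> r" for u
        using e[OF tv] e[of u] comp'[OF that tv zv] that tv rtrans by (metis transD)
      then show "z \<in> D t" using zP by (auto simp: D_def)
    qed
    let ?U = "D ` {t. (s, t) \<in> r}"
    have "\<Inter>F \<noteq> {}" if F: "finite F" "F \<subseteq> ?U" for F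
    proof -
      obtain A where A: "finite A" "A \<subseteq> {t. (s, t) \<in> r}" "F = D ` A"
        using F by (meson finite_subset_image)
      obtain u where u: "u \<in> I" "\<forall>t\<in>insert s A. (t, u) \<in> r"
        using directed_poset_finite_ub[OF dir, of "insert s A"] A s rI by blast
      have "D u \<subseteq> \<Inter>F" using A(3) u mono by blast
      then show ?thesis using neD[of u] u by auto
    qed
    moreover have "\<forall>C\<in>?U. closedin ?P C" using clD rI by auto
    ultimately have "\<Inter>?U \<noteq> {}"
      using comP[unfolded compact_space_fip, rule_format, of ?U] by simp
    then obtain z where z: "\<And>t. (s, t) \<in> r \<Longrightarrow> z \<in> D t" by blast
    have zs: "z s = a" and zP: "z \<in> topspace ?P" using z[OF rrefl[OF s]] by (auto simp: D_def)
    have thr: "\<pi> u t (z t) = z u" if ut: "(u, t) \<in> r" for u t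
    proof -
      obtain v where v: "(s, v) \<in> r" "(t, v) \<in> r" using ub[of s t] s ut rI by blast
      then have "z \<in> D t" using mono[OF v(2)] z[OF v(1)] by blast
      then show ?thesis using ut by (auto simp: D_def)
    qed
    have "\<exists>x\<in>topspace X. \<forall>s\<in>I. p s x = z s"
      by (rule is_inverse_limitD(4)[OF lim]) (use zP rI thr in auto)
    then show "a \<in> p s ` topspace X" using zs s by force
  qed
qed

lemma compact_functorD:
  assumes F: "compact_functor Fo Fm"
  shows "compact_Hausdorff Y \<Longrightarrow> compact_Hausdorff (Fo Y)"
    and "compact_Hausdorff Y \<Longrightarrow> compact_Hausdorff Z \<Longrightarrow> continuous_map Y Z f \<Longrightarrow>
           continuous_map (Fo Y) (Fo Z) (Fm Y Z f)"
    and "compact_Hausdorff Y \<Longrightarrow> compact_Hausdorff Z \<Longrightarrow> compact_Hausdorff W \<Longrightarrow>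
           continuous_map Y Z f \<Longrightarrow> continuous_map Z W f' \<Longrightarrow> continuous_map Y W f'' \<Longrightarrow>
           (\<And>y. y \<in> topspace Y \<Longrightarrow> f' (f y) = f'' y) \<Longrightarrow> a \<in> topspace (Fo Y) \<Longrightarrow>
           Fm Z W f' (Fm Y Z f a) = Fm Y W f'' a"
proof -
  note F' = F[unfolded compact_functor_def]
  note F2 = F'[THEN conjunct2] note F3 = F2[THEN conjunct2]
  note F4 = F3[THEN conjunct2] note F5 = F4[THEN conjunct2]
  show "compact_Hausdorff (Fo Y)" if "compact_Hausdorff Y"
    using F'[THEN conjunct1, THEN spec, THEN mp, OF that] .
  show "continuous_map (Fo Y) (Fo Z) (Fm Y Z f)"
    if Y: "compact_Hausdorff Y" and Z: "compact_Hausdorff Z" and f: "continuous_map Y Z f"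
    using F2[THEN conjunct1, THEN spec, THEN spec, THEN spec, THEN mp,
        OF conjI[OF Y conjI[OF Z f]]] .
  show "Fm Z W f' (Fm Y Z f a) = Fm Y W f'' a"
    if Y: "compact_Hausdorff Y" and Z: "compact_Hausdorff Z" and W: "compact_Hausdorff W"
      and f: "continuous_map Y Z f" and f': "continuous_map Z W f'" and f'': "continuous_map Y W f''"
      and eq: "\<And>y. y \<in> topspace Y \<Longrightarrow> f' (f y) = f'' y" and a: "a \<in> topspace (Fo Y)"
  proof -
    have c: "continuous_map Y W (f' \<circ> f)" by (rule continuous_map_compose[OF f f'])
    have e: "\<forall>y\<in>topspace Y. (f' \<circ> f) y = f'' y" using eq by simp
    have "Fm Y W (f' \<circ> f) a = Fm Z W f' (Fm Y Z f a)"
      using F5[THEN spec, THEN spec, THEN spec, THEN spec, THEN spec, THEN mp,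
          OF conjI[OF Y conjI[OF Z conjI[OF W conjI[OF f f']]]], THEN bspec, OF a] .
    moreover have "Fm Y W (f' \<circ> f) a = Fm Y W f'' a"
      using F3[THEN conjunct1, THEN spec, THEN spec, THEN spec, THEN spec, THEN mp,
          OF conjI[OF Y conjI[OF W conjI[OF c conjI[OF f'' e]]]], THEN bspec, OF a] .
    ultimately show ?thesis by simp
  qed
qed

theorem continuous_functor_any_index:
  fixes Fo :: "'a topology \<Rightarrow> 'b topology"
  assumes F: "compact_functor Fo Fm" and cF: "continuous_functor Fo Fm"
  shows "preserves_limits_over TYPE('i) Fo Fm"
  unfolding preserves_limits_over_def
proof (intro allI impI, elim conjE)
  fix I :: "'i set" and r and S :: "'i \<Rightarrow> 'a topology" and \<pi> X p
  assume sys: "inverse_system I r S \<pi>" and compS0: "\<forall>s\<in>I. compact_Hausdorff (S s)"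
    and surj: "\<forall>(s, t)\<in>r. \<pi> s t ` topspace (S t) = topspace (S s)"
    and X1: "compact_space X" and X2: "Hausdorff_space X"
    and lim: "is_inverse_limit I r S \<pi> X p"
  note compS = compS0[rule_format]
  have X: "compact_Hausdorff X" using X1 X2 by simp
  have dir: "directed_poset I r" using sys by (simp add: inverse_system_def)
  then have rI: "r \<subseteq> I \<times> I" and ne: "I \<noteq> {}"
    by (auto simp: directed_poset_def partial_order_on_def preorder_on_def)
  have ub: "\<exists>u\<in>I. (t, u) \<in> r \<and> (t', u) \<in> r" if "t \<in> I" "t' \<in> I" for t t'
    using dir that by (auto simp: directed_poset_def)
  have cp: "continuous_map X (S s) (p s)" if "s \<in> I" for s
    using is_inverse_limitD(1)[OF lim that] .
  have pcomm: "\<pi> s t (p t x) = p s x" if "x \<in> topspace X" "(s, t) \<in> r" for x s t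
    using is_inverse_limitD(2)[OF lim that] rI that by blast
  have surj': "\<pi> s t ` topspace (S t) = topspace (S s)" if "(s, t) \<in> r" for s t
    using bspec[OF surj that] by simp
  have psurj: "p s ` topspace X = topspace (S s)" if "s \<in> I" for s
    by (rule inverse_limit_projection_surj[OF sys compS surj' lim that])
  have lift: "\<exists>x\<in>topspace X. y = p s x" if "s \<in> I" "y \<in> topspace (S s)" for s y
    using psurj[OF that(1)] that(2) by (metis imageE)
  have c\<pi>: "continuous_map (S t) (S s) (\<pi> s t)" if "(s, t) \<in> r" for s t
    using sys that by (auto simp: inverse_system_def)

  define k where "k s = {(x, y). x \<in> topspace X \<and> y \<in> topspace X \<and> p s x = p s y}" for s
  define h where "h s t y = p s (SOME x. x \<in> topspace X \<and> p t x = y)" for s t y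
  have hp: "h s t (p t x) = p s x" if "k t \<subseteq> k s" "x \<in> topspace X" for s t x
  proof -
    let ?x = "SOME x'. x' \<in> topspace X \<and> p t x' = p t x"
    have "?x \<in> topspace X \<and> p t ?x = p t x"
      by (rule someI[of _ x]) (use that in auto)
    then have "(?x, x) \<in> k t" using that by (auto simp: k_def)
    then have "(?x, x) \<in> k s" using that by blast
    then show ?thesis by (auto simp: k_def h_def)
  qed
  have ch: "continuous_map (S t) (S s) (h s t)" if "s \<in> I" "t \<in> I" "k t \<subseteq> k s" for s t
  proof -
    have q: "quotient_map X (S t) (p t)"
      using X compS[OF that(2)] cp[OF that(2)] psurj[OF that(2)]
      by (intro continuous_closed_imp_quotient_map) (auto intro: continuous_imp_closed_map)
    have "continuous_map X (S s) (h s t \<circ> p t)"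
      by (rule continuous_map_eq[OF cp[OF that(1)]]) (use hp that in auto)
    then show ?thesis using q continuous_compose_quotient_map by blast
  qed
  have kmono: "k t \<subseteq> k s" if "(s, t) \<in> r" for s t
    unfolding k_def using pcomm[OF _ that] by clarsimp metis
  have h\<pi>: "h s t (\<pi> t u y) = \<pi> s u y"
    if *: "k t \<subseteq> k s" "(t, u) \<in> r" "(s, u) \<in> r" "y \<in> topspace (S u)" for s t u y
  proof -
    obtain x where x: "x \<in> topspace X" "y = p u x"
      using lift[of u y] * rI by blast
    then show ?thesis using pcomm * hp by simp
  qed

  define g where "g = inv_into I k"
  define J where "J = k ` I"
  have g: "g d \<in> I" "k (g d) = d" if "d \<in> J" for d
    using that by (auto simp: g_def J_def inv_into_into f_inv_into_f)
  define R where "R = {(d, e). d \<in> J \<and> e \<in> J \<and> e \<subseteq> d}"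
  have RJ: "R \<subseteq> J \<times> J" by (auto simp: R_def)
  have Rk: "k (g e) \<subseteq> k (g d)" "g d \<in> I" "g e \<in> I" if "(d, e) \<in> R" for d e
    using that g by (auto simp: R_def)
  let ?S = "\<lambda>d. S (g d)" and ?\<pi> = "\<lambda>d e. h (g d) (g e)" and ?p = "\<lambda>d. p (g d)"
  have "directed_poset J R"
    unfolding directed_poset_def
  proof (intro conjI ballI)
    show "partial_order_on J R"
      by (auto simp: partial_order_on_def preorder_on_def R_def refl_on_def trans_def antisym_def)
    show "J \<noteq> {}" using ne by (simp add: J_def)
    fix d e assume "d \<in> J" "e \<in> J"
    then obtain s t where st: "s \<in> I" "t \<in> I" "d = k s" "e = k t" by (auto simp: J_def)
    then obtain u where "u \<in> I" "(s, u) \<in> r" "(t, u) \<in> r" using ub by blast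
    then show "\<exists>u\<in>J. (d, u) \<in> R \<and> (e, u) \<in> R"
      using st kmono by (intro bexI[of _ "k u"]) (auto simp: R_def J_def)
  qed
  moreover have "\<forall>d\<in>J. \<forall>y\<in>topspace (?S d). ?\<pi> d d y = y"
  proof (intro ballI)
    fix d y assume "d \<in> J" "y \<in> topspace (?S d)"
    then obtain x where "x \<in> topspace X" "y = p (g d) x" using lift[of "g d" y] g by blast
    then show "?\<pi> d d y = y" using hp[of "g d" "g d"] by simp
  qed
  moreover have "\<forall>d e f. (d, e) \<in> R \<and> (e, f) \<in> R \<longrightarrow>
      (\<forall>y\<in>topspace (?S f). ?\<pi> d e (?\<pi> e f y) = ?\<pi> d f y)"
  proof (intro allI impI ballI, elim conjE)
    fix d e f y assume *: "(d, e) \<in> R" "(e, f) \<in> R" and y: "y \<in> topspace (?S f)"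
    obtain x where "x \<in> topspace X" "y = p (g f) x" using lift[of "g f" y] y Rk[OF *(2)] by blast
    then show "?\<pi> d e (?\<pi> e f y) = ?\<pi> d f y"
      using Rk(1)[OF *(1)] Rk(1)[OF *(2)] by (simp add: hp)
  qed
  ultimately have sysJ: "inverse_system J R ?S ?\<pi>"
    unfolding inverse_system_def using ch Rk by auto
  have compJ: "\<forall>d\<in>J. compact_Hausdorff (?S d)" using compS g by simp
  have surjJ: "\<forall>(d, e)\<in>R. ?\<pi> d e ` topspace (?S e) = topspace (?S d)"
  proof safe
    fix d e assume de: "(d, e) \<in> R"
    have "?\<pi> d e ` topspace (?S e) = (\<lambda>x. ?\<pi> d e (p (g e) x)) ` topspace X"
      using psurj[OF Rk(3)[OF de]] by (metis image_image)
    also have "\<dots> = p (g d) ` topspace X"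
      using hp[OF Rk(1)[OF de]] by (auto simp: image_iff)
    finally have eq: "?\<pi> d e ` topspace (?S e) = topspace (?S d)" using psurj[OF Rk(2)[OF de]] by simp
    show "\<And>y. y \<in> topspace (?S e) \<Longrightarrow> ?\<pi> d e y \<in> topspace (?S d)" using eq by blast
    show "\<And>y. y \<in> topspace (?S d) \<Longrightarrow> y \<in> ?\<pi> d e ` topspace (?S e)" using eq by blast
  qed
  have limJ: "is_inverse_limit J R ?S ?\<pi> X ?p"
  proof (rule is_inverse_limitI[OF _ _ RJ])
    show "compact_space X" using X by simp
    show "Hausdorff_space (?S d)" "continuous_map X (?S d) (?p d)" if "d \<in> J" for d
      using compJ that cp g by auto
    show "?\<pi> d e (?p e x) = ?p d x" if "x \<in> topspace X" "(d, e) \<in> R" for x d e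
      using hp Rk that by blast
    show "x = y" if xy: "x \<in> topspace X" "y \<in> topspace X" and eq: "\<And>d. d \<in> J \<Longrightarrow> ?p d x = ?p d y" for x y
    proof (rule is_inverse_limitD(3)[OF lim xy])
      fix s assume s: "s \<in> I"
      then have "k s \<in> J" by (simp add: J_def)
      then have "(x, y) \<in> k (g (k s))" using eq xy unfolding k_def[of "g (k s)"] by blast
      then have "(x, y) \<in> k s" using g(2)[OF \<open>k s \<in> J\<close>] by simp
      then show "p s x = p s y" by (simp add: k_def)
    qed
    fix z assume zS: "\<And>d. d \<in> J \<Longrightarrow> z d \<in> topspace (?S d)"
      and zt: "\<And>d e. (d, e) \<in> R \<Longrightarrow> ?\<pi> d e (z e) = z d"
    have kJ: "k s \<in> J" if "s \<in> I" for s using that by (simp add: J_def)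
    define w where "w s = h s (g (k s)) (z (k s))" for s
    have "\<exists>x\<in>topspace X. \<forall>s\<in>I. p s x = w s"
    proof (rule is_inverse_limitD(4)[OF lim _ rI])
      show "w s \<in> topspace (S s)" if "s \<in> I" for s
        using ch[of s "g (k s)"] g[OF kJ[OF that]] zS[OF kJ[OF that]] that
        by (auto simp: w_def continuous_map_def)
      fix s t assume st: "(s, t) \<in> r"
      have sI: "s \<in> I" and tI: "t \<in> I" using st rI by auto
      have R: "(k s, k t) \<in> R" using kmono[OF st] kJ sI tI by (auto simp: R_def)
      obtain x where x: "x \<in> topspace X" "z (k t) = p (g (k t)) x"
        using lift[OF g(1)[OF kJ[OF tI]] zS[OF kJ[OF tI]]] by blast
      have "z (k s) = p (g (k s)) x"
        using zt[OF R] x hp[OF Rk(1)[OF R]] by simp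
      then show "\<pi> s t (w t) = w s"
        using x hp[of "g (k t)" t] hp[of "g (k s)" s] g(2) kJ sI tI pcomm[OF x(1) st]
        by (simp add: w_def)
    qed
    then obtain x where x: "x \<in> topspace X" "\<And>s. s \<in> I \<Longrightarrow> p s x = w s" by blast
    have "?p d x = z d" if d: "d \<in> J" for d
    proof -
      have "(d, d) \<in> R" using d by (auto simp: R_def)
      then show ?thesis using x(2)[OF g(1)[OF d]] zt g(2)[OF d] by (simp add: w_def)
    qed
    then show "\<exists>x\<in>topspace X. \<forall>d\<in>J. ?p d x = z d" using x(1) by blast
  qed
  have limF: "is_inverse_limit J R (\<lambda>d. Fo (?S d)) (\<lambda>d e. Fm (?S e) (?S d) (?\<pi> d e))
      (Fo X) (\<lambda>d. Fm X (?S d) (?p d))"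
    using cF[unfolded continuous_functor_def preserves_limits_over_def, THEN spec[where x=J],
        THEN spec[where x=R], THEN spec[where x="?S"], THEN spec[where x="?\<pi>"],
        THEN spec[where x=X], THEN spec[where x="?p"], THEN mp,
        OF conjI[OF sysJ conjI[OF compJ conjI[OF surjJ conjI[OF X limJ]]]]] .

  note Fobj = compact_functorD(1)[OF F] and Fcont = compact_functorD(2)[OF F]
    and Fcomp = compact_functorD(3)[OF F]
  show "is_inverse_limit I r (\<lambda>s. Fo (S s)) (\<lambda>s t. Fm (S t) (S s) (\<pi> s t))
      (Fo X) (\<lambda>s. Fm X (S s) (p s))"
  proof (rule is_inverse_limitI[OF _ _ rI])
    show "compact_space (Fo X)" using Fobj X by simp
    show "Hausdorff_space (Fo (S s))" "continuous_map (Fo X) (Fo (S s)) (Fm X (S s) (p s))"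
      if "s \<in> I" for s
      using Fobj[OF compS[OF that]] Fcont[OF X compS[OF that] cp[OF that]] by auto
    show "Fm (S t) (S s) (\<pi> s t) (Fm X (S t) (p t) a) = Fm X (S s) (p s) a"
      if a: "a \<in> topspace (Fo X)" and st: "(s, t) \<in> r" for a s t
    proof -
      have "s \<in> I" "t \<in> I" using st rI by auto
      then show ?thesis using Fcomp[OF X compS compS cp c\<pi>[OF st] cp pcomm[OF _ st] a] by simp
    qed
    show "a = b" if ab: "a \<in> topspace (Fo X)" "b \<in> topspace (Fo X)"
      and eq: "\<And>s. s \<in> I \<Longrightarrow> Fm X (S s) (p s) a = Fm X (S s) (p s) b" for a b
      by (rule is_inverse_limitD(3)[OF limF ab]) (use eq g in auto)
    fix w assume wS: "\<And>s. s \<in> I \<Longrightarrow> w s \<in> topspace (Fo (S s))"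
      and wt: "\<And>s t. (s, t) \<in> r \<Longrightarrow> Fm (S t) (S s) (\<pi> s t) (w t) = w s"
    have wh: "Fm (S t) (S s) (h s t) (w t) = w s" if st: "s \<in> I" "t \<in> I" "k t \<subseteq> k s" for s t
    proof -
      obtain u where u: "u \<in> I" "(s, u) \<in> r" "(t, u) \<in> r" using ub st by blast
      have "Fm (S t) (S s) (h s t) (Fm (S u) (S t) (\<pi> t u) (w u)) = Fm (S u) (S s) (\<pi> s u) (w u)"
        using compS u st c\<pi> ch wS h\<pi> by (intro Fcomp) auto
      then show ?thesis using wt u by simp
    qed
    have "\<exists>a\<in>topspace (Fo X). \<forall>d\<in>J. Fm X (?S d) (?p d) a = w (g d)"
      by (rule is_inverse_limitD(4)[OF limF _ RJ]) (use wS wh g Rk in auto)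
    then obtain a where a: "a \<in> topspace (Fo X)"
      "\<And>d. d \<in> J \<Longrightarrow> Fm X (?S d) (?p d) a = w (g d)" by blast
    have "Fm X (S s) (p s) a = w s" if s: "s \<in> I" for s
    proof -
      let ?t = "g (k s)"
      have kJ: "k s \<in> J" using s by (simp add: J_def)
      note t = g[OF kJ]
      have "Fm (S ?t) (S s) (h s ?t) (Fm X (S ?t) (p ?t) a) = Fm X (S s) (p s) a"
        using X compS s t cp ch hp a(1) by (intro Fcomp) auto
      then show ?thesis using a(2)[OF kJ] wh[OF s t(1)] t(2) by simp
    qed
    then show "\<exists>a\<in>topspace (Fo X). \<forall>s\<in>I. Fm X (S s) (p s) a = w s" using a(1) by blast
  qed
qed

end

(* Truncating a Valdivia compactum K, embedded in [0,1]^T, to the coordinates in B maps K into itself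
   as soon as B is closed under a suitable countable-valued operation on finite subsets of T. These
   truncations r_B commute, satisfy r_A r_B = r_{A Int B}, turn directed unions of index sets into
   inverse limits, and have metrizable images for countable B. A continuous weight preserving functor
   keeps all of this, so it suffices to prove that a compact space with such a system of retractions
   R_B is Valdivia. A separating family of functions, point-countable on the dense union of the images
   of R_B for countable B, is built by induction on the cardinality of an index set A: exhaust A by
   a continuous chain of smaller closed sets and take the functions f o R_{a+1} - f o R_a, with f from
   the family for stage a+1. *)

theory Submission
  imports Defs "HOL-Library.Countable_Set_Type"
begin

section \<open>Sets closed under countably many finitary operations\<close>

text \<open>The obstacle is that \<open>Fo K\<close> carries no coordinates, and an embedding of
  \<open>K\<close> into a cube says nothing about one for \<open>Fo K\<close>. The embedding is
  therefore traded for data that a functor can transport over the same \<open>T\<close> and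
  \<open>Op\<close>. The rules for composing retractions are equations between maps, kept by
  functoriality. That a retraction at a directed union is determined by those at its members is an
  inverse limit statement, kept by continuity. Metrizability of the images for countable index sets
  is countable weight, kept by weight preservation. Coordinates for \<open>Fo K\<close> are then
  rebuilt from the retractions alone. Truncation to an arbitrary subset of \<open>T\<close> may lead
  out of the image of \<open>K\<close>; this is why closed index sets appear at all.\<close>

lemma finite_subset_directed_Union:
  assumes "finite F" "F \<subseteq> \<Union>\<D>" "\<D> \<noteq> {}"
    and dir: "\<And>A B. A \<in> \<D> \<Longrightarrow> B \<in> \<D> \<Longrightarrow> \<exists>C\<in>\<D>. A \<union> B \<subseteq> C"
  shows "\<exists>B\<in>\<D>. F \<subseteq> B"
  using assms(1,2)
proof (induction F)
  case empty
  then show ?case using assms(3) by blast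
next
  case (insert a F)
  then obtain A B where "A \<in> \<D>" "F \<subseteq> A" "B \<in> \<D>" "a \<in> B" by auto
  then show ?case using dir[of A B] by blast
qed

text \<open>A set of size \<open>n + 1\<close> is a point inserted into a set of size
  \<open>n\<close>, so for each \<open>n\<close> the bound follows from products of sets of size at
  most an infinite \<open>r\<close>. The countable union over \<open>n\<close> stays below
  \<open>r\<close> as well.\<close>

lemma finite_subsets_ordLeq:
  assumes r: "Card_order r" "\<not> finite (Field r)" and B: "|B| \<le>o r"
  shows "|{F. F \<subseteq> B \<and> finite F}| \<le>o r"
proof -
  let ?P = "\<lambda>n. {F. F \<subseteq> B \<and> finite F \<and> card F = n}"
  have P: "|?P n| \<le>o r" for n
  proof (induction n)
    case 0
    have "?P 0 = {{}}" by auto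
    moreover have "|{{}}| \<le>o |Field r|" using r(2) by (intro card_of_singl_ordLeq) auto
    ultimately show ?case
      using ordLeq_ordIso_trans[OF _ card_of_Field_ordIso[OF r(1)]] by metis
  next
    case (Suc n)
    have "?P (Suc n) \<subseteq> (\<lambda>(x, F). insert x F) ` (B \<times> ?P n)"
    proof
      fix F assume F: "F \<in> ?P (Suc n)"
      then obtain x where x: "x \<in> F" by fastforce
      then have "F - {x} \<in> ?P n" using F by auto
      moreover have "x \<in> B" using x F by auto
      ultimately show "F \<in> (\<lambda>(x, F). insert x F) ` (B \<times> ?P n)"
        using x by (intro image_eqI[of _ _ "(x, F - {x})"]) (simp_all add: insert_absorb)
    qed
    then have "|?P (Suc n)| \<le>o |B \<times> ?P n|"
      by (rule ordLeq_transitive[OF card_of_mono1 card_of_image])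
    also have "|B \<times> ?P n| \<le>o r"
      by (rule card_of_Times_ordLeq_infinite_Field[OF r(2) B Suc r(1)])
    finally show ?case .
  qed
  have "|UNIV :: nat set| \<le>o r"
    using r infinite_iff_card_of_nat card_of_Field_ordIso ordLeq_ordIso_trans by blast
  then have "|\<Union>n. ?P n| \<le>o r"
    using P by (intro card_of_UNION_ordLeq_infinite_Field r) auto
  moreover have "(\<Union>n. ?P n) = {F. F \<subseteq> B \<and> finite F}" by auto
  ultimately show ?thesis by simp
qed

text \<open>The two restrictions on \<open>Op\<close> serve different ends. Finite arguments make
  closed sets stable under directed unions; countable values keep the closure of a set within any
  infinite cardinal that bounds the set.\<close>

locale countable_closure =
  fixes T :: "'t set" and Op :: "'t set \<Rightarrow> 't set"
  assumes Op_subset: "finite F \<Longrightarrow> F \<subseteq> T \<Longrightarrow> Op F \<subseteq> T"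
    and countable_Op: "finite F \<Longrightarrow> F \<subseteq> T \<Longrightarrow> countable (Op F)"
begin

definition closed_set :: "'t set \<Rightarrow> bool" where
  "closed_set B \<longleftrightarrow> B \<subseteq> T \<and> (\<forall>F. finite F \<and> F \<subseteq> B \<longrightarrow> Op F \<subseteq> B)"

text \<open>Meaningful for subsets of \<open>T\<close>, where \<open>T\<close> itself is a closed
  superset. For any other \<open>S\<close> the hull is an intersection over the empty family, hence
  \<open>UNIV\<close>.\<close>

definition cl :: "'t set \<Rightarrow> 't set" where
  "cl S = closed_set hull S"

lemma closed_set_subset: "closed_set B \<Longrightarrow> B \<subseteq> T"
  by (simp add: closed_set_def)

lemma closed_set_T: "closed_set T"
  by (simp add: closed_set_def Op_subset)

lemma closed_set_Int: "closed_set A \<Longrightarrow> closed_set B \<Longrightarrow> closed_set (A \<inter> B)"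
  by (auto simp: closed_set_def)

lemma closed_set_Inter: "\<D> \<noteq> {} \<Longrightarrow> (\<And>B. B \<in> \<D> \<Longrightarrow> closed_set B) \<Longrightarrow> closed_set (\<Inter>\<D>)"
  unfolding closed_set_def
  by (intro conjI allI impI Inter_greatest) (blast, metis Inter_lower order_trans)

lemma closed_set_directed_Union:
  assumes cl: "\<And>B. B \<in> \<D> \<Longrightarrow> closed_set B" and ne: "\<D> \<noteq> {}"
    and dir: "\<And>A B. A \<in> \<D> \<Longrightarrow> B \<in> \<D> \<Longrightarrow> \<exists>C\<in>\<D>. A \<union> B \<subseteq> C"
  shows "closed_set (\<Union>\<D>)"
  unfolding closed_set_def
proof (intro conjI allI impI)
  show "\<Union>\<D> \<subseteq> T" using cl closed_set_subset by blast
  fix F assume "finite F \<and> F \<subseteq> \<Union>\<D>"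
  then obtain B where "B \<in> \<D>" "F \<subseteq> B" "finite F"
    using finite_subset_directed_Union[OF _ _ ne dir] by metis
  then show "Op F \<subseteq> \<Union>\<D>" using cl[of B] by (metis Union_upper closed_set_def order_trans)
qed

lemma closed_set_cl: "S \<subseteq> T \<Longrightarrow> closed_set (cl S)"
  unfolding cl_def hull_def using closed_set_T by (intro closed_set_Inter) auto

lemma subset_cl: "S \<subseteq> cl S"
  unfolding cl_def by (rule hull_subset)

lemma cl_mono: "S \<subseteq> S' \<Longrightarrow> cl S \<subseteq> cl S'"
  unfolding cl_def by (rule hull_mono)

lemma cl_minimal: "S \<subseteq> B \<Longrightarrow> closed_set B \<Longrightarrow> cl S \<subseteq> B"
  unfolding cl_def by (rule hull_minimal)

text \<open>This makes a chain of closures continuous: at a limit index the closure is the union of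
  the earlier closures, so no point of difference can first appear there.\<close>

lemma cl_directed_Union:
  assumes sub: "\<Union>\<D> \<subseteq> T" and ne: "\<D> \<noteq> {}"
    and dir: "\<And>A B. A \<in> \<D> \<Longrightarrow> B \<in> \<D> \<Longrightarrow> \<exists>C\<in>\<D>. A \<union> B \<subseteq> C"
  shows "cl (\<Union>\<D>) = \<Union>(cl ` \<D>)"
proof
  have "closed_set (\<Union>(cl ` \<D>))"
  proof (rule closed_set_directed_Union)
    show "closed_set B" if "B \<in> cl ` \<D>" for B
      using that sub closed_set_cl by blast
    show "\<exists>C\<in>cl ` \<D>. A \<union> B \<subseteq> C" if AB: "A \<in> cl ` \<D>" "B \<in> cl ` \<D>" for A B
    proof -
      obtain A' B' where "A' \<in> \<D>" "B' \<in> \<D>" "A = cl A'" "B = cl B'" using AB by blast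
      moreover then obtain C where "C \<in> \<D>" "A' \<union> B' \<subseteq> C" using dir by blast
      ultimately show ?thesis using cl_mono[of A' C] cl_mono[of B' C] by auto
    qed
  qed (use ne in auto)
  then show "cl (\<Union>\<D>) \<subseteq> \<Union>(cl ` \<D>)"
    using subset_cl by (intro cl_minimal) fast+
  show "\<Union>(cl ` \<D>) \<subseteq> cl (\<Union>\<D>)"
    using cl_mono by blast
qed

text \<open>Countably many rounds of adding all values of \<open>Op\<close> suffice: a finite subset
  of the union already lies in some round, and the next round contains its value. Each round adds at
  most \<open>r\<close> countable sets.\<close>

lemma cl_ordLeq:
  assumes r: "Card_order r" "\<not> finite (Field r)" and S: "S \<subseteq> T" "|S| \<le>o r"
  shows "|cl S| \<le>o r"
proof -
  define step where "step B = B \<union> \<Union>(Op ` {F. F \<subseteq> B \<and> finite F})" for B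
  define C where "C n = (step ^^ n) S" for n
  have nat: "|UNIV :: nat set| \<le>o r"
    using r infinite_iff_card_of_nat card_of_Field_ordIso ordLeq_ordIso_trans by blast
  have C: "C n \<subseteq> T \<and> |C n| \<le>o r" for n
  proof (induction n)
    case 0
    then show ?case using S by (simp add: C_def)
  next
    case (Suc n)
    have "|Op F| \<le>o r" if "F \<subseteq> C n" "finite F" for F
      using countable_Op[of F] that Suc nat
      by (meson countable_card_of_nat ordLeq_transitive subset_trans)
    then have "|\<Union>F\<in>{F. F \<subseteq> C n \<and> finite F}. Op F| \<le>o r"
      using r finite_subsets_ordLeq Suc by (intro card_of_UNION_ordLeq_infinite_Field) auto
    moreover have "(\<Union>F\<in>{F. F \<subseteq> C n \<and> finite F}. Op F) \<subseteq> T"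
      using Op_subset Suc by (intro UN_least) (metis (mono_tags, lifting) mem_Collect_eq order_trans)
    ultimately show ?case
      using Suc r by (auto simp: C_def step_def intro!: card_of_Un_ordLeq_infinite_Field)
  qed
  have mono: "C m \<subseteq> C n" if "m \<le> n" for m n
    by (rule lift_Suc_mono_le[OF _ that]) (auto simp: C_def step_def)
  have "closed_set (\<Union>n. C n)"
    unfolding closed_set_def
  proof (intro conjI allI impI)
    show "(\<Union>n. C n) \<subseteq> T" using C by blast
    fix F assume F: "finite F \<and> F \<subseteq> (\<Union>n. C n)"
    have "\<exists>B\<in>range C. F \<subseteq> B"
    proof (rule finite_subset_directed_Union)
      show "\<exists>D\<in>range C. A \<union> B \<subseteq> D" if AB: "A \<in> range C" "B \<in> range C" for A B
      proof -
        obtain m n where "A = C m" "B = C n" using AB by blast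
        then show ?thesis
          using mono[of m "max m n"] mono[of n "max m n"] by auto
      qed
    qed (use F in auto)
    then obtain n where "F \<subseteq> C n" by blast
    then have "Op F \<subseteq> C (Suc n)" using F by (auto simp: C_def step_def)
    then show "Op F \<subseteq> (\<Union>n. C n)" by blast
  qed
  moreover have "S \<subseteq> (\<Union>n. C n)" unfolding C_def using funpow_0[of step S] by (metis UN_upper UNIV_I)
  ultimately have "cl S \<subseteq> (\<Union>n. C n)" by (rule cl_minimal[rotated])
  moreover have "|\<Union>n. C n| \<le>o r"
    using nat C by (intro card_of_UNION_ordLeq_infinite_Field r) auto
  ultimately show ?thesis using card_of_mono1 ordLeq_transitive by blast
qed

lemma countable_cl: "S \<subseteq> T \<Longrightarrow> countable S \<Longrightarrow> countable (cl S)"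
  using cl_ordLeq[OF card_of_Card_order, of "UNIV :: nat set" S]
  by (simp add: countable_card_of_nat Field_card_of)

end


section \<open>Separating families of continuous functions\<close>

text \<open>Finite intersections of preimages of rational intervals form the base. For
  \<open>x\<close> in an open \<open>U\<close>, every \<open>y\<close> outside \<open>U\<close> is
  cut off from \<open>x\<close> by one such preimage, and compactness of the complement leaves
  finitely many of them.\<close>

lemma countable_base_of_separating:
  assumes X: "compact_space X" and \<Phi>: "countable \<Phi>"
    and cont: "\<And>f. f \<in> \<Phi> \<Longrightarrow> continuous_map X euclideanreal f"
    and sep: "\<And>x y. x \<in> topspace X \<Longrightarrow> y \<in> topspace X \<Longrightarrow> x \<noteq> y \<Longrightarrow> \<exists>f\<in>\<Phi>. f x \<noteq> f y"
  shows "\<exists>B. countable B \<and> open_base X B"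
proof -
  define N where "N = (\<lambda>(f, p, q). {x \<in> topspace X. f x \<in> {p<..<q::real}})"
  define S where "S = N ` (\<Phi> \<times> \<rat> \<times> \<rat>)"
  \<comment> \<open>Intersecting with \<open>topspace X\<close> gives the empty family a proper
    value; that family arises when the complement of \<open>U\<close> is empty.\<close>
  define B where "B = (\<lambda>F. topspace X \<inter> \<Inter>F) ` {F. F \<subseteq> S \<and> finite F}"
  have "countable S" unfolding S_def using \<Phi> countable_rat by (intro countable_image countable_SIGMA) auto
  then have "countable B" unfolding B_def
    by (intro countable_image) (metis (no_types, lifting) Collect_cong conj_commute countable_Collect_finite_subset)
  have opS: "openin X V" if "V \<in> S" for V
    using that cont openin_continuous_map_preimage[of X euclideanreal _ "{_<..<_}"]
    by (fastforce simp: S_def N_def)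
  have SN: "N (f, p, q) \<in> S" if "f \<in> \<Phi>" "p \<in> \<rat>" "q \<in> \<rat>" for f p q
    using that by (auto simp: S_def)
  have pt: "\<exists>V\<in>S. \<exists>W. openin X W \<and> x \<in> V \<and> y \<in> W \<and> V \<inter> W = {}"
    if xy: "x \<in> topspace X" "y \<in> topspace X" "x \<noteq> y" for x y
  proof -
    obtain f where f: "f \<in> \<Phi>" "f x \<noteq> f y" using sep[OF xy] by blast
    have op: "openin X {z \<in> topspace X. f z \<in> A}" if "open A" for A
      using openin_continuous_map_preimage[OF cont[OF f(1)]] that by auto
    \<comment> \<open>The intervals in \<open>S\<close> are bounded, so \<open>p\<close> and
      \<open>q\<close> close off the side of \<open>f x\<close> that does not face
      \<open>f y\<close>.\<close>
    obtain p q where pq: "p \<in> \<rat>" "q \<in> \<rat>" "p < f x" "f x < q"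
      by (meson Rats_dense_in_real lt_ex gt_ex)
    show ?thesis
    proof (cases "f x < f y")
      case True
      obtain c where c: "c \<in> \<rat>" "f x < c" "c < f y" using Rats_dense_in_real[OF True] by blast
      show ?thesis
        by (intro bexI[of _ "N (f, p, c)"] exI[of _ "{z \<in> topspace X. f z \<in> {c<..}}"])
          (use c pq xy op[of "{c<..}"] SN[OF f(1)] in \<open>auto simp: N_def\<close>)
    next
      case False
      then obtain c where c: "c \<in> \<rat>" "f y < c" "c < f x"
        using Rats_dense_in_real[of "f y" "f x"] f(2) by force
      show ?thesis
        by (intro bexI[of _ "N (f, c, q)"] exI[of _ "{z \<in> topspace X. f z \<in> {..<c}}"])
          (use c pq xy op[of "{..<c}"] SN[OF f(1)] in \<open>auto simp: N_def\<close>)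
    qed
  qed
  have "open_base X B"
    unfolding open_base_def
  proof (intro conjI allI impI ballI)
    fix V assume "V \<in> B"
    then obtain F where F: "F \<subseteq> S" "finite F" "V = topspace X \<inter> \<Inter>F" by (auto simp: B_def)
    then show "openin X V"
      using opS openin_Inter[of "insert (topspace X) F" X] by auto
  next
    fix U x assume U: "openin X U \<and> x \<in> U"
    then have x: "x \<in> topspace X" using openin_subset by blast
    define C where "C = topspace X - U"
    have "\<forall>y\<in>C. \<exists>V W. V \<in> S \<and> openin X W \<and> x \<in> V \<and> y \<in> W \<and> V \<inter> W = {}"
      using pt[OF x] U by (auto simp: C_def) metis
    then obtain V W where VW: "\<And>y. y \<in> C \<Longrightarrow>
        V y \<in> S \<and> openin X (W y) \<and> x \<in> V y \<and> y \<in> W y \<and> V y \<inter> W y = {}"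
      by metis
    have "compactin X C"
      using X U unfolding C_def by (intro closedin_compact_space) auto
    then obtain \<F> where "finite \<F>" "\<F> \<subseteq> W ` C" "C \<subseteq> \<Union>\<F>"
      using compactinD[of X C "W ` C"] VW by blast
    then obtain Y where Y: "finite Y" "Y \<subseteq> C" "C \<subseteq> \<Union>(W ` Y)"
      using finite_subset_image[of \<F> W C] by blast
    show "\<exists>V\<in>B. x \<in> V \<and> V \<subseteq> U"
    proof (intro bexI conjI)
      show "topspace X \<inter> \<Inter>(V ` Y) \<in> B" using Y VW by (auto simp: B_def)
      show "x \<in> topspace X \<inter> \<Inter>(V ` Y)" using Y VW x by blast
      show "topspace X \<inter> \<Inter>(V ` Y) \<subseteq> U"
      proof
        fix z assume z: "z \<in> topspace X \<inter> \<Inter>(V ` Y)"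
        show "z \<in> U"
        proof (rule ccontr)
          assume "z \<notin> U"
          then obtain y where "y \<in> Y" "z \<in> W y" using z Y by (auto simp: C_def)
          then show False using VW[of y] Y z by blast
        qed
      qed
    qed
  qed
  with \<open>countable B\<close> show ?thesis by blast
qed

text \<open>One function is chosen for each pair of basic sets that some function tells apart.
  Urysohn functions show that every two distinct points lie in such a pair.\<close>

lemma separating_of_countable_base:
  assumes X: "compact_Hausdorff X" and B: "countable B" "open_base X B"
  shows "\<exists>\<Phi>. countable \<Phi> \<and> (\<forall>f\<in>\<Phi>. continuous_map X euclideanreal f) \<and>
    (\<forall>x\<in>topspace X. \<forall>y\<in>topspace X. x \<noteq> y \<longrightarrow> (\<exists>f\<in>\<Phi>. f x \<noteq> f y))"
proof -
  define P where "P U V f \<longleftrightarrow> continuous_map X euclideanreal f \<and> (\<forall>u\<in>U. \<forall>v\<in>V. f u \<noteq> f v)" for U V f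
  define \<Phi> where "\<Phi> = (\<lambda>(U, V). SOME f. P U V f) ` {(U, V). U \<in> B \<and> V \<in> B \<and> (\<exists>f. P U V f)}"
  have P: "P U V (SOME f. P U V f)" if "P U V f" for U V f using someI[of "P U V" f] that by blast
  have "countable (B \<times> B)" using B by blast
  then have "countable \<Phi>"
    unfolding \<Phi>_def by (rule countable_image[OF countable_subset, rotated]) blast
  moreover have "\<forall>f\<in>\<Phi>. continuous_map X euclideanreal f"
    using P by (force simp: \<Phi>_def P_def)
  moreover have "\<exists>f\<in>\<Phi>. f x \<noteq> f y" if xy: "x \<in> topspace X" "y \<in> topspace X" "x \<noteq> y" for x y
  proof -
    have "closedin X {x}" "closedin X {y}"
      using X xy by (simp_all add: closedin_Hausdorff_sing_eq)
    moreover have "normal_space X" using X compact_Hausdorff_or_regular_imp_normal_space by blast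
    ultimately obtain g where g: "continuous_map X euclideanreal g" "g ` {x} \<subseteq> {0}" "g ` {y} \<subseteq> {1}"
      using Urysohn_lemma_alt[of X "{x}" "{y}" 0 1] xy by (auto simp: disjnt_def)
    have op: "openin X {z \<in> topspace X. g z \<in> A}" if "open A" for A
      using openin_continuous_map_preimage[OF g(1)] that by auto
    have base: "\<exists>V\<in>B. z \<in> V \<and> V \<subseteq> U" if "openin X U" "z \<in> U" for U z
      using B(2) that by (simp add: open_base_def)
    obtain U where "U \<in> B" "x \<in> U" "U \<subseteq> {z \<in> topspace X. g z \<in> {..<1/2}}"
      using base[OF op[of "{..<1/2}"], of x] xy g by auto
    moreover obtain V where "V \<in> B" "y \<in> V" "V \<subseteq> {z \<in> topspace X. g z \<in> {1/2<..}}"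
      using base[OF op[of "{1/2<..}"], of y] xy g by auto
    moreover from calculation have "P U V g" using g(1) by (fastforce simp: P_def)
    ultimately show ?thesis
      using P[of U V g] by (intro bexI[of _ "SOME f. P U V f"]) (auto simp: P_def \<Phi>_def)
  qed
  ultimately show ?thesis by blast
qed

text \<open>The image of \<open>h\<close> is closed, and \<open>h\<close> carries the dense set
  \<open>D\<close> into the Sigma-product; these give the two inclusions of the density
  condition.\<close>

lemma valdivia_compact_of_separating:
  assumes X: "compact_Hausdorff X"
    and cont: "\<And>f. f \<in> \<Phi> \<Longrightarrow> continuous_map X euclideanreal f"
    and sep: "\<And>x y. x \<in> topspace X \<Longrightarrow> y \<in> topspace X \<Longrightarrow> x \<noteq> y \<Longrightarrow> \<exists>f\<in>\<Phi>. f x \<noteq> f y"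
    and D: "D \<subseteq> topspace X" "X closure_of D = topspace X"
    and ctb: "\<And>x. x \<in> D \<Longrightarrow> countable {f \<in> \<Phi>. f x \<noteq> 0}"
  shows "valdivia_compact X"
proof -
  \<comment> \<open>Squashes the positive part into the unit interval. It fixes 0, so a vanishing
    \<open>f\<close> gives a vanishing coordinate, but it forgets negative values. Hence the sign in
    \<open>T\<close>: the values at \<open>f x\<close> and at \<open>- f x\<close> together
    determine \<open>f x\<close>.\<close>
  define \<phi> where "\<phi> t = max 0 t / (1 + max 0 t)" for t :: real
  define T where "T = \<Phi> \<times> {1, -1 :: real}"
  define h where "h x = (\<lambda>(f, c)\<in>T. \<phi> (c * f x))" for x
  have \<phi>01: "\<phi> t \<in> {0..1}" for t by (auto simp: \<phi>_def)
  have \<phi>0: "\<phi> 0 = 0" by (simp add: \<phi>_def)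
  have \<phi>inj: "s = t" if "\<phi> s = \<phi> t" "\<phi> (- s) = \<phi> (- t)" for s t
    using that unfolding \<phi>_def max_def
    by (auto simp: divide_simps algebra_simps split: if_splits)
  have \<phi>cont: "continuous_on UNIV \<phi>"
    unfolding \<phi>_def by (intro continuous_intros) (auto simp: max_def)
  have conth: "continuous_map X (cube T) h"
    unfolding cube_def continuous_map_componentwise
  proof (intro conjI ballI)
    show "h ` topspace X \<subseteq> extensional T" by (auto simp: h_def)
    fix i assume i: "i \<in> T"
    obtain f c where fc: "i = (f, c)" by (cases i)
    have "continuous_map X euclideanreal (\<lambda>x. c * f x)"
      using cont i fc by (intro continuous_intros) (auto simp: T_def)
    then have "continuous_map X euclideanreal (\<phi> \<circ> (\<lambda>x. c * f x))"
      using \<phi>cont by (intro continuous_map_compose) auto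
    then show "continuous_map X (top_of_set {0..1}) (\<lambda>x. h x i)"
      using i fc \<phi>01 by (auto simp: continuous_map_in_subtopology h_def o_def)
  qed
  have injh: "inj_on h (topspace X)"
  proof (rule inj_onI, rule ccontr)
    fix x y assume xy: "x \<in> topspace X" "y \<in> topspace X" "h x = h y" "x \<noteq> y"
    then obtain f where f: "f \<in> \<Phi>" "f x \<noteq> f y" using sep by blast
    have "h x (f, 1) = h y (f, 1)" "h x (f, -1) = h y (f, -1)" using xy by auto
    then show False using f \<phi>inj[of "f x" "f y"] by (simp add: h_def T_def)
  qed
  have clmap: "closed_map X (cube T) h"
    using X conth Hausdorff_cube by (blast intro: continuous_imp_closed_map)
  have emb: "embedding_map X (cube T) h"
    by (rule injective_closed_imp_embedding_map[OF conth clmap injh])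
  have cl: "closedin (cube T) (h ` topspace X)"
    using clmap by (auto simp: closed_map_def)
  have sub: "h ` D \<subseteq> Sigma_prod T \<inter> h ` topspace X"
  proof safe
    fix x assume x: "x \<in> D"
    have "{i \<in> T. h x i \<noteq> 0} \<subseteq> {f \<in> \<Phi>. f x \<noteq> 0} \<times> {1, -1}"
      using \<phi>0 by (auto simp: T_def h_def)
    then have "countable {i \<in> T. h x i \<noteq> 0}"
      by (rule countable_subset) (use ctb[OF x] in auto)
    moreover have "h x \<in> topspace (cube T)"
      using conth x D by (auto simp: continuous_map_def)
    ultimately show "h x \<in> Sigma_prod T" by (simp add: Sigma_prod_def)
    show "h x \<in> h ` topspace X" using x D by blast
  qed
  have "h ` topspace X \<subseteq> cube T closure_of (h ` D)"
    using continuous_map_image_closure_subset[OF conth, of D] D by simp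
  also have "\<dots> \<subseteq> cube T closure_of (Sigma_prod T \<inter> h ` topspace X)"
    by (rule closure_of_mono[OF sub])
  finally have "h ` topspace X = cube T closure_of (Sigma_prod T \<inter> h ` topspace X)"
    using closure_of_minimal[OF _ cl, of "Sigma_prod T \<inter> h ` topspace X"] by blast
  then show ?thesis
    using emb by (intro valdivia_compactI[OF X]) (auto simp: valdivia_embedding_def)
qed


section \<open>Commuting retractions\<close>

text \<open>\<open>R_Union\<close> is only the injective half of the statement that the image at a
  directed union is the limit of the earlier images; the surjective half follows from compactness.
  \<open>countable_separating\<close> makes the images for countable \<open>B\<close> metrizable,
  since distinct points fixed by \<open>R B\<close> are separated by countably many
  functions.\<close>

locale retraction_system = countable_closure T Op
  for T :: "'t set" and Op :: "'t set \<Rightarrow> 't set" +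
  fixes X :: "'a topology" and R :: "'t set \<Rightarrow> 'a \<Rightarrow> 'a"
  assumes compact_Hausdorff: "compact_Hausdorff X"
    and cont: "closed_set A \<Longrightarrow> continuous_map X X (R A)"
    and R_R: "closed_set A \<Longrightarrow> closed_set B \<Longrightarrow> x \<in> topspace X \<Longrightarrow> R A (R B x) = R (A \<inter> B) x"
    and R_T: "x \<in> topspace X \<Longrightarrow> R T x = x"
    and R_Union: "(\<And>B. B \<in> \<D> \<Longrightarrow> closed_set B) \<Longrightarrow> \<D> \<noteq> {} \<Longrightarrow>
       (\<And>A B. A \<in> \<D> \<Longrightarrow> B \<in> \<D> \<Longrightarrow> \<exists>C\<in>\<D>. A \<union> B \<subseteq> C) \<Longrightarrow>
       x \<in> topspace X \<Longrightarrow> y \<in> topspace X \<Longrightarrow> (\<And>B. B \<in> \<D> \<Longrightarrow> R B x = R B y) \<Longrightarrow>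
       R (\<Union>\<D>) x = R (\<Union>\<D>) y"
    and countable_separating: "closed_set B \<Longrightarrow> countable B \<Longrightarrow>
       \<exists>\<Phi>. countable \<Phi> \<and> (\<forall>f\<in>\<Phi>. continuous_map X euclideanreal f) \<and>
         (\<forall>x\<in>topspace X. \<forall>y\<in>topspace X. R B x \<noteq> R B y \<longrightarrow> (\<exists>f\<in>\<Phi>. f x \<noteq> f y))"
begin

lemma R_in: "closed_set A \<Longrightarrow> x \<in> topspace X \<Longrightarrow> R A x \<in> topspace X"
  using cont by (auto simp: continuous_map_def)

lemma R_idem: "closed_set A \<Longrightarrow> x \<in> topspace X \<Longrightarrow> R A (R A x) = R A x"
  by (simp add: R_R)

lemma R_subset:
  "closed_set A \<Longrightarrow> closed_set B \<Longrightarrow> A \<subseteq> B \<Longrightarrow> x \<in> topspace X \<Longrightarrow> R A (R B x) = R A x"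
  by (simp add: R_R Int_absorb2)

section \<open>Density of the points fixed by a retraction with countable index set\<close>

definition countable_part :: "'a set" where
  "countable_part = {x \<in> topspace X. \<exists>B. closed_set B \<and> countable B \<and> R B x = x}"

lemma R_countable_part:
  assumes A: "closed_set A" and x: "x \<in> countable_part"
  shows "R A x \<in> countable_part"
proof -
  obtain B where B: "closed_set B" "countable B" "R B x = x" and xX: "x \<in> topspace X"
    using x by (auto simp: countable_part_def)
  have "R B (R A x) = R A (R B x)" using A B(1) xX R_R by (metis Int_commute)
  then show ?thesis using A B xX R_in by (auto simp: countable_part_def)
qed

lemma countable_subsets_cover:
  assumes "A \<subseteq> T"
  shows "A \<subseteq> \<Union>{B. closed_set B \<and> countable B}"
proof
  fix t assume "t \<in> A"
  then have "closed_set (cl {t})" "countable (cl {t})" "t \<in> cl {t}"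
    using assms closed_set_cl[of "{t}"] countable_cl[of "{t}"] subset_cl[of "{t}"] by auto
  then show "t \<in> \<Union>{B. closed_set B \<and> countable B}" by blast
qed

lemma countable_closed_directed:
  assumes "closed_set A" "countable A" "closed_set B" "countable B"
  shows "closed_set (cl (A \<union> B)) \<and> countable (cl (A \<union> B)) \<and> A \<union> B \<subseteq> cl (A \<union> B)"
  using assms closed_set_cl[of "A \<union> B"] countable_cl[of "A \<union> B"] subset_cl[of "A \<union> B"]
    closed_set_subset by auto

text \<open>The solutions of \<open>R B c = z B\<close> inside \<open>C\<close> form closed sets
  with the finite intersection property, as \<open>z B\<close> solves the conditions for all smaller
  index sets. It is used with \<open>C\<close> a closure, to prove density, and with
  \<open>C\<close> the whole space, to realize threads.\<close>

lemma thread_in_closed_set: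
  assumes cl: "\<And>B. B \<in> \<D> \<Longrightarrow> closed_set B" and ne: "\<D> \<noteq> {}"
    and dir: "\<And>A B. A \<in> \<D> \<Longrightarrow> B \<in> \<D> \<Longrightarrow> \<exists>C\<in>\<D>. A \<union> B \<subseteq> C"
    and C: "closedin X C" and z: "\<And>B. B \<in> \<D> \<Longrightarrow> z B \<in> C"
    and thr: "\<And>A B. A \<in> \<D> \<Longrightarrow> B \<in> \<D> \<Longrightarrow> A \<subseteq> B \<Longrightarrow> R A (z B) = z A"
  shows "\<exists>c\<in>C. \<forall>B\<in>\<D>. R B c = z B"
proof -
  have CX: "C \<subseteq> topspace X" using C closedin_subset by blast
  define E where "E B = {c \<in> topspace X. R B c = z B} \<inter> C" for B
  have clE: "closedin X (E B)" if "B \<in> \<D>" for B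
    unfolding E_def using compact_Hausdorff cont[OF cl[OF that]] z[OF that] C CX
    by (intro closedin_Int closedin_continuous_maps_eq[where Y=X]) auto
  have zE: "z B \<in> E A" if "A \<in> \<D>" "B \<in> \<D>" "A \<subseteq> B" for A B
    using thr[OF that] z[OF that(2)] CX by (auto simp: E_def)
  have "\<Inter>F \<noteq> {}" if F: "finite F" "F \<subseteq> E ` \<D>" for F
  proof -
    obtain \<A> where \<A>: "\<A> \<subseteq> \<D>" "finite \<A>" "F = E ` \<A>"
      using finite_subset_image[OF F] by blast
    have "\<exists>B\<in>\<D>. \<forall>A\<in>\<A>. A \<subseteq> B"
      using \<A>(2,1)
    proof (induction \<A>)
      case empty
      then show ?case using ne by blast
    next
      case (insert A \<A>)
      then obtain B where B: "B \<in> \<D>" "\<forall>A\<in>\<A>. A \<subseteq> B" by auto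
      then obtain B' where "B' \<in> \<D>" "A \<union> B \<subseteq> B'" using dir insert.prems by blast
      then show ?case using B(2) by (intro bexI[of _ B']) auto
    qed
    then obtain B where B: "B \<in> \<D>" "\<forall>A\<in>\<A>. A \<subseteq> B" by blast
    have "z B \<in> E A" if "A \<in> \<A>" for A
      by (rule zE) (use that B \<A>(1) in auto)
    then show ?thesis unfolding \<A>(3) by blast
  qed
  moreover have "\<forall>S\<in>E ` \<D>. closedin X S" using clE by blast
  ultimately have "\<Inter>(E ` \<D>) \<noteq> {}"
    using compact_Hausdorff[THEN conjunct1, unfolded compact_space_fip, rule_format, of "E ` \<D>"]
    by blast
  then obtain c where c: "\<And>B. B \<in> \<D> \<Longrightarrow> c \<in> E B" by blast
  then show ?thesis using ne by (auto simp: E_def)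
qed

text \<open>The points \<open>R B a\<close> for countable \<open>B\<close> form a thread in the
  closure, so some \<open>c\<close> in the closure has the same retracts as \<open>a\<close>. The
  countable closed sets are directed with union \<open>T\<close>, and \<open>R T\<close> is the
  identity, so \<open>c = a\<close>.\<close>

lemma countable_part_dense: "X closure_of countable_part = topspace X"
proof
  show "X closure_of countable_part \<subseteq> topspace X" by (rule closure_of_subset_topspace)
  let ?\<D> = "{B. closed_set B \<and> countable B}"
  let ?C = "X closure_of countable_part"
  have sub: "countable_part \<subseteq> ?C"
    by (rule closure_of_subset) (auto simp: countable_part_def)
  have ne: "?\<D> \<noteq> {}" using closed_set_cl[of "{}"] countable_cl[of "{}"] by auto
  have dir: "\<exists>C\<in>?\<D>. A \<union> B \<subseteq> C" if "A \<in> ?\<D>" "B \<in> ?\<D>" for A B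
    using countable_closed_directed[of A B] that by blast
  have UD: "\<Union>?\<D> = T"
    using countable_subsets_cover[of T] closed_set_subset by blast
  show "topspace X \<subseteq> ?C"
  proof
    fix a assume a: "a \<in> topspace X"
    have "\<exists>c\<in>?C. \<forall>B\<in>?\<D>. R B c = R B a"
    proof (rule thread_in_closed_set[OF _ ne dir])
      show "R B a \<in> ?C" if "B \<in> ?\<D>" for B
      proof -
        have "R B a \<in> countable_part" using that a R_idem R_in by (auto simp: countable_part_def)
        then show ?thesis using sub by blast
      qed
    qed (use a R_subset in auto)
    then obtain c where c: "c \<in> ?C" "\<And>B. B \<in> ?\<D> \<Longrightarrow> R B c = R B a" by blast
    then have cX: "c \<in> topspace X" by (metis closure_of_subset_topspace subsetD)
    have "R (\<Union>?\<D>) c = R (\<Union>?\<D>) a"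
      by (rule R_Union[OF _ ne dir cX a c(2)]) simp
    then show "a \<in> ?C" unfolding UD using R_T cX a c(1) by simp
  qed
qed

text \<open>The functions live on all of \<open>X\<close> rather than on the image of
  \<open>R A\<close>, and countability is asked on the whole of \<open>countable_part\<close>, so
  that families belonging to different index sets can be united.\<close>

definition point_countable_separating :: "('a \<Rightarrow> real) set \<Rightarrow> 't set \<Rightarrow> bool" where
  "point_countable_separating \<Phi> A \<longleftrightarrow> (\<forall>f\<in>\<Phi>. continuous_map X euclideanreal f) \<and>
     (\<forall>x\<in>countable_part. countable {f \<in> \<Phi>. f x \<noteq> 0}) \<and>
     (\<forall>x\<in>topspace X. \<forall>y\<in>topspace X. R A x \<noteq> R A y \<longrightarrow> (\<exists>f\<in>\<Phi>. f x \<noteq> f y))"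

text \<open>If \<open>R B x = x\<close>, then \<open>R (A' a) x \<noteq> R (A a) x\<close> forces \<open>B\<close> to meet \<open>A' a - A a\<close>; for countable
  \<open>B\<close> this leaves countably many \<open>a\<close>, and \<open>f \<circ> R (A' a) - f \<circ> R (A a)\<close> vanishes at \<open>x\<close> for all others.\<close>

lemma point_countable_separating_chain:
  assumes A: "\<And>a. a \<in> I \<Longrightarrow> closed_set (A a) \<and> closed_set (A' a) \<and> A a \<subseteq> A' a"
    and disj: "\<And>a b. a \<in> I \<Longrightarrow> b \<in> I \<Longrightarrow> a \<noteq> b \<Longrightarrow> (A' a - A a) \<inter> (A' b - A b) = {}"
    and \<Phi>: "\<And>a. a \<in> I \<Longrightarrow> point_countable_separating (\<Phi> a) (A' a)"
    and \<Psi>: "point_countable_separating \<Psi> A0"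
    and sep: "\<And>x y. x \<in> topspace X \<Longrightarrow> y \<in> topspace X \<Longrightarrow> R C x \<noteq> R C y \<Longrightarrow> R A0 x = R A0 y \<Longrightarrow>
       \<exists>a\<in>I. R (A a) x = R (A a) y \<and> R (A' a) x \<noteq> R (A' a) y"
  shows "\<exists>\<Theta>. point_countable_separating \<Theta> C"
proof -
  define g where "g a f x = f (R (A' a) x) - f (R (A a) x)" for a and f :: "'a \<Rightarrow> real" and x
  let ?\<Theta> = "\<Psi> \<union> (\<Union>a\<in>I. g a ` \<Phi> a)"
  have c: "continuous_map X euclideanreal f" if "f \<in> ?\<Theta>" for f
  proof -
    have "continuous_map X euclideanreal (g a f)" if "a \<in> I" "f \<in> \<Phi> a" for a f
    proof -
      have f: "continuous_map X euclideanreal f"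
        using \<Phi> that by (auto simp: point_countable_separating_def)
      show ?thesis unfolding g_def
        using continuous_map_compose[OF cont f] A[OF that(1)]
        by (intro continuous_map_diff) (auto simp: o_def)
    qed
    then show ?thesis using that \<Psi> by (auto simp: point_countable_separating_def)
  qed
  have ctb: "countable {f \<in> ?\<Theta>. f x \<noteq> 0}" if x: "x \<in> countable_part" for x
  proof -
    obtain B where B: "closed_set B" "countable B" "R B x = x" and xX: "x \<in> topspace X"
      using x by (auto simp: countable_part_def)
    define J where "J = {a \<in> I. B \<inter> (A' a - A a) \<noteq> {}}"
    define e where "e a = (SOME t. t \<in> B \<inter> (A' a - A a))" for a
    have e: "e a \<in> B \<inter> (A' a - A a)" if "a \<in> J" for a
      unfolding e_def by (rule someI_ex) (use that in \<open>auto simp: J_def\<close>)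
    have "inj_on e J"
    proof (rule inj_onI, rule ccontr)
      fix a b assume ab: "a \<in> J" "b \<in> J" "e a = e b" "a \<noteq> b"
      then show False using disj[of a b] e[of a] e[of b] by (auto simp: J_def)
    qed
    moreover have "e ` J \<subseteq> B" using e by blast
    ultimately have J: "countable J"
      using B(2) countable_image_inj_on countable_subset by blast
    have fixed: "R (A' a) x = R (A a) x" if "a \<in> I" "a \<notin> J" for a
    proof -
      have "A' a \<inter> B = A a \<inter> B" using A[OF that(1)] that by (auto simp: J_def)
      then show ?thesis using A[OF that(1)] R_R[OF _ B(1) xX] B(3) by metis
    qed
    let ?N = "\<lambda>a y. {f \<in> \<Phi> a. f y \<noteq> 0}"
    have sub: "{f \<in> ?\<Theta>. f x \<noteq> 0} \<subseteq> {f \<in> \<Psi>. f x \<noteq> 0} \<union>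
        (\<Union>a\<in>J. g a ` (?N a (R (A' a) x) \<union> ?N a (R (A a) x)))"
    proof
      fix f assume f: "f \<in> {f \<in> ?\<Theta>. f x \<noteq> 0}"
      show "f \<in> {f \<in> \<Psi>. f x \<noteq> 0} \<union> (\<Union>a\<in>J. g a ` (?N a (R (A' a) x) \<union> ?N a (R (A a) x)))"
      proof (cases "f \<in> \<Psi>")
        case False
        then obtain a f' where a: "a \<in> I" "f' \<in> \<Phi> a" "f = g a f'" using f by blast
        have nz: "g a f' x \<noteq> 0" using f a by simp
        then have "a \<in> J" using fixed[OF a(1)] by (metis diff_self g_def)
        moreover have "f' \<in> ?N a (R (A' a) x) \<union> ?N a (R (A a) x)"
          using nz a by (auto simp: g_def)
        ultimately show ?thesis using a by blast
      qed (use f in simp)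
    qed
    \<comment> \<open>Point-countability of \<open>\<Phi> a\<close> is applied at the two retracts
      of \<open>x\<close>, which again lie in \<open>countable_part\<close>.\<close>
    have "countable (?N a (R (A' a) x) \<union> ?N a (R (A a) x))" if "a \<in> I" for a
      using \<Phi>[OF that] A[OF that] R_countable_part[OF _ x]
      by (simp add: point_countable_separating_def)
    moreover have "countable {f \<in> \<Psi>. f x \<noteq> 0}"
      using \<Psi> x by (simp add: point_countable_separating_def)
    ultimately show ?thesis
      using J by (intro countable_subset[OF sub]) (auto simp: J_def)
  qed
  have sep': "\<exists>f\<in>?\<Theta>. f x \<noteq> f y"
    if xy: "x \<in> topspace X" "y \<in> topspace X" "R C x \<noteq> R C y" for x y
  proof (cases "R A0 x = R A0 y")
    case False
    then have "\<exists>f\<in>\<Psi>. f x \<noteq> f y" using \<Psi> xy unfolding point_countable_separating_def by blast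
    then show ?thesis by blast
  next
    case True
    then obtain a where a: "a \<in> I" "R (A a) x = R (A a) y" "R (A' a) x \<noteq> R (A' a) y"
      using sep[OF xy] by blast
    have A': "closed_set (A' a)" using A a by blast
    \<comment> \<open>\<open>\<Phi> a\<close> is applied to the retracts, which
      \<open>R (A' a)\<close> fixes; the subtracted terms of \<open>g a f\<close> agree at
      \<open>x\<close> and \<open>y\<close>, so the difference survives.\<close>
    have "R (A' a) (R (A' a) x) \<noteq> R (A' a) (R (A' a) y)"
      using a xy A' R_idem by simp
    then obtain f where f: "f \<in> \<Phi> a" "f (R (A' a) x) \<noteq> f (R (A' a) y)"
      using \<Phi>[OF a(1)] R_in[OF A'] xy unfolding point_countable_separating_def by blast
    then have "g a f x \<noteq> g a f y" using a by (simp add: g_def)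
    then show ?thesis using f a by blast
  qed
  have "point_countable_separating ?\<Theta> C"
    unfolding point_countable_separating_def by (intro conjI ballI impI c ctb sep')
  then show ?thesis by blast
qed

section \<open>Existence of separating families by induction on cardinality\<close>

lemma point_countable_separating_countable:
  assumes "closed_set B" "countable B"
  shows "\<exists>\<Phi>. point_countable_separating \<Phi> B"
proof -
  obtain \<Phi> where \<Phi>: "countable \<Phi>" "\<forall>f\<in>\<Phi>. continuous_map X euclideanreal f"
    "\<forall>x\<in>topspace X. \<forall>y\<in>topspace X. R B x \<noteq> R B y \<longrightarrow> (\<exists>f\<in>\<Phi>. f x \<noteq> f y)"
    using countable_separating[OF assms] by blast
  then have "countable {f \<in> \<Phi>. f x \<noteq> 0}" for x
    using countable_subset[of "{f \<in> \<Phi>. f x \<noteq> 0}" \<Phi>] by blast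
  then show ?thesis using \<Phi> unfolding point_countable_separating_def by blast
qed

lemma point_countable_separating_exists:
  assumes "closed_set A"
  shows "\<exists>\<Phi>. point_countable_separating \<Phi> A"
  using assms
proof (induction A rule: wf_induct_rule[OF wf_inv_image[OF wf_ordLess, of card_of]])
  case (1 A)
  show ?case
  proof (cases "countable A")
    case True
    then show ?thesis using point_countable_separating_countable 1 by blast
  next
    case False
    then have infA: "infinite A" using countable_finite by blast
    have AT: "A \<subseteq> T" using 1 closed_set_subset by blast
    \<comment> \<open>\<open>A\<close> is enumerated by its own cardinal order, whose proper initial
      segments are strictly smaller than \<open>A\<close>.\<close>
    define r where "r = |A|"
    have r: "Card_order r" "Field r = A"
      unfolding r_def by (rule card_of_Card_order, rule Field_card_of)
    then have wor: "wo_rel r" by (simp add: wo_rel_def card_order_on_def)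
    define L where "L a = cl (underS r a)" for a
    define U where "U a = cl (under r a)" for a
    have uT: "underS r a \<subseteq> T" "under r a \<subseteq> T" for a
      using AT r(2) underS_Field under_Field by fast+
    have clLU: "closed_set (L a)" "closed_set (U a)" "L a \<subseteq> U a" for a
      using uT closed_set_cl cl_mono[OF underS_subset_under] by (auto simp: L_def U_def)
    \<comment> \<open>This makes the differences \<open>U a - L a\<close> pairwise disjoint.\<close>
    have UL: "U a \<subseteq> L b" if "(a, b) \<in> r" "a \<noteq> b" for a b
      unfolding U_def L_def
    proof (rule cl_mono)
      show "under r a \<subseteq> underS r b"
        using that wo_rel.TRANS[OF wor] wo_rel.ANTISYM[OF wor]
        by (auto simp: under_def underS_def dest: transD antisymD)
    qed
    have UA: "U a \<subseteq> A" for a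
      unfolding U_def using 1 r(2) under_Field by (intro cl_minimal) fast+
    \<comment> \<open>A finite segment may have an infinite, though countable, closure; here the
      bound comes from \<open>A\<close> being uncountable. An infinite segment has a closure no
      larger than itself.\<close>
    have small: "|U a| <o |A|" if a: "a \<in> A" for a
    proof (cases "finite (under r a)")
      case True
      then have "countable (U a)" unfolding U_def using uT by (intro countable_cl) (auto simp: countable_finite)
      then have "|U a| \<le>o |UNIV :: nat set|" by (simp add: countable_card_of_nat)
      moreover have "|UNIV :: nat set| <o |A|"
        using False countable_card_of_nat[of A]
        by (simp add: not_ordLeq_iff_ordLess[symmetric] card_of_Well_order)
      ultimately show ?thesis by (rule ordLeq_ordLess_trans)
    next
      case inf: False
      have eq: "under r a = underS r a \<union> {a}"
        using a r wo_rel.REFL[OF wor] by (auto simp: under_def underS_def refl_on_def)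
      then have infS: "infinite (underS r a)" using inf by simp
      then have "|{a}| \<le>o |underS r a|" by (intro card_of_singl_ordLeq) auto
      then have "|under r a| \<le>o |underS r a|"
        unfolding eq using infS card_of_Card_order card_of_mono1
        by (intro card_of_Un_ordLeq_infinite_Field) (auto simp: Field_card_of)
      also have "|underS r a| <o |A|" using card_of_underS[OF r(1)] a r by (simp add: r_def)
      finally have "|under r a| <o |A|" .
      moreover have "|U a| \<le>o |under r a|"
        unfolding U_def using inf uT
        by (intro cl_ordLeq card_of_Card_order ordLeq_refl) (simp_all add: Field_card_of)
      ultimately show ?thesis by (rule ordLeq_ordLess_trans[rotated])
    qed
    have "\<exists>\<Phi>. point_countable_separating \<Phi> (U a)" if "a \<in> A" for a
      using 1(1)[of "U a"] small[OF that] clLU by simp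
    then obtain \<Phi> where \<Phi>: "\<And>a. a \<in> A \<Longrightarrow> point_countable_separating (\<Phi> a) (U a)" by metis
    \<comment> \<open>The chain starts at \<open>cl {}\<close>, which need not be empty. Pairs
      already told apart there produce no jump along the chain and are left to
      \<open>\<Psi>\<close>.\<close>
    obtain \<Psi> where \<Psi>: "point_countable_separating \<Psi> (cl {})"
      using point_countable_separating_countable[of "cl {}"] closed_set_cl countable_cl by auto
    show ?thesis
    proof (rule point_countable_separating_chain[where I=A and A=L and A'=U, OF _ _ \<Phi> \<Psi>])
      show "closed_set (L a) \<and> closed_set (U a) \<and> L a \<subseteq> U a" for a using clLU by blast
      show "(U a - L a) \<inter> (U b - L b) = {}" if "a \<in> A" "b \<in> A" "a \<noteq> b" for a b
        using wo_rel.TOTALS[OF wor] that r(2) UL by blast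
      fix x y assume xy: "x \<in> topspace X" "y \<in> topspace X" "R A x \<noteq> R A y" "R (cl {}) x = R (cl {}) y"
      \<comment> \<open>At the first stage telling \<open>x\<close> and \<open>y\<close> apart, all
        earlier stages agree, and \<open>L a\<close> is the union of those stages (or
        \<open>cl {}\<close> if there are none), so the difference arises exactly between
        \<open>L a\<close> and \<open>U a\<close>.\<close>
      define N where "N = {a \<in> A. R (U a) x \<noteq> R (U a) y}"
      have dir: "\<exists>C\<in>U ` M. B \<union> B' \<subseteq> C" if M: "M \<subseteq> A" "B \<in> U ` M" "B' \<in> U ` M" for M B B'
      proof -
        obtain a b where ab: "a \<in> M" "b \<in> M" "B = U a" "B' = U b" using M by blast
        then have "(a, b) \<in> r \<or> (b, a) \<in> r"
          using wo_rel.TOTALS[OF wor] M r(2) by blast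
        then have "U a \<subseteq> U b \<or> U b \<subseteq> U a" using UL clLU(3) by blast
        then show ?thesis using ab by blast
      qed
      have N: "N \<noteq> {}"
      proof
        assume "N = {}"
        then have "R (\<Union>(U ` A)) x = R (\<Union>(U ` A)) y"
          using xy infA clLU by (intro R_Union dir[of A]) (auto simp: N_def)
        moreover have "a \<in> U a" if "a \<in> A" for a
          using that subset_cl[of "under r a"] r wo_rel.REFL[OF wor]
          by (auto simp: U_def under_def refl_on_def)
        then have "\<Union>(U ` A) = A" using UA by blast
        ultimately show False using xy by simp
      qed
      moreover have "N \<subseteq> Field r" using r by (auto simp: N_def)
      ultimately obtain a where a: "a \<in> N" "\<And>b. b \<in> N \<Longrightarrow> (a, b) \<in> r"
        using wo_rel.Well_order_isMinim_exists[OF wor, of N] by (auto simp: wo_rel.isMinim_def[OF wor])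
      have aA: "a \<in> A" using a by (simp add: N_def)
      have "R (L a) x = R (L a) y"
      proof (cases "underS r a = {}")
        case True
        then show ?thesis using xy by (simp add: L_def)
      next
        case False
        have uA: "underS r a \<subseteq> A" using underS_Field r by fast
        have "under r b \<subseteq> underS r a" "b \<in> under r b" if "b \<in> underS r a" for b
          using that wo_rel.TRANS[OF wor] wo_rel.ANTISYM[OF wor] wo_rel.REFL[OF wor] r(2) uA
          by (auto simp: under_def underS_def refl_on_def dest: transD antisymD)
        then have "underS r a = \<Union>(under r ` underS r a)" by blast
        moreover have "cl (\<Union>(under r ` underS r a)) = \<Union>(cl ` under r ` underS r a)"
        proof (rule cl_directed_Union)
          show "\<exists>C\<in>under r ` underS r a. B \<union> B' \<subseteq> C"
            if BB: "B \<in> under r ` underS r a" "B' \<in> under r ` underS r a" for B B'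
          proof -
            obtain b b' where b: "b \<in> underS r a" "b' \<in> underS r a" "B = under r b" "B' = under r b'"
              using BB by blast
            then have "(b, b') \<in> r \<or> (b', b) \<in> r"
              using wo_rel.TOTALS[OF wor] uA r(2) by blast
            then have "B \<subseteq> B' \<or> B' \<subseteq> B"
              using b wo_rel.TRANS[OF wor] by (auto simp: under_def dest: transD)
            then show ?thesis using BB by blast
          qed
        qed (use False uT in auto)
        ultimately have La: "L a = \<Union>(U ` underS r a)" by (simp add: L_def U_def image_image)
        have "b \<notin> N" if "b \<in> underS r a" for b
          using that a(2)[of b] wo_rel.ANTISYM[OF wor] by (auto simp: underS_def dest: antisymD)
        then show ?thesis unfolding La
          using xy False uA clLU by (intro R_Union dir[of "underS r a"]) (auto simp: N_def)
      qed
      then show "\<exists>a\<in>A. R (L a) x = R (L a) y \<and> R (U a) x \<noteq> R (U a) y"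
        using a by (auto simp: N_def)
    qed
  qed
qed

theorem valdivia_compact: "valdivia_compact X"
proof -
  obtain \<Phi> where \<Phi>: "point_countable_separating \<Phi> T"
    using point_countable_separating_exists[OF closed_set_T] by blast
  show ?thesis
  proof (rule valdivia_compact_of_separating[OF compact_Hausdorff _ _ _ countable_part_dense])
    show "continuous_map X euclideanreal f" if "f \<in> \<Phi>" for f
      using \<Phi> that by (simp add: point_countable_separating_def)
    show "\<exists>f\<in>\<Phi>. f x \<noteq> f y" if "x \<in> topspace X" "y \<in> topspace X" "x \<noteq> y" for x y
      using \<Phi> that R_T by (simp add: point_countable_separating_def)
    show "countable_part \<subseteq> topspace X" by (auto simp: countable_part_def)
    show "countable {f \<in> \<Phi>. f x \<noteq> 0}" if "x \<in> countable_part" for x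
      using \<Phi> that by (simp add: point_countable_separating_def)
  qed
qed

end


section \<open>Images of retraction systems under functors\<close>

context retraction_system
begin

text \<open>Continuity of the functor concerns systems with surjective bonding maps, so
  \<open>R A\<close> has to be viewed as a map onto its image.\<close>

definition stage :: "'t set \<Rightarrow> 'a topology" where
  "stage A = subtopology X (R A ` topspace X)"

lemma topspace_stage: "closed_set A \<Longrightarrow> topspace (stage A) = R A ` topspace X"
  using R_in by (auto simp: stage_def)

lemma stage_fixed: "closed_set A \<Longrightarrow> x \<in> topspace (stage A) \<longleftrightarrow> x \<in> topspace X \<and> R A x = x"
  using R_in R_idem by (force simp: topspace_stage)

lemma compact_Hausdorff_stage:
  assumes "closed_set A"
  shows "compact_Hausdorff (stage A)"
proof
  have "compactin X (R A ` topspace X)"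
    using compact_Hausdorff cont[OF assms] image_compactin compact_space_def by blast
  then show "compact_space (stage A)" by (simp add: stage_def compact_space_subtopology)
  show "Hausdorff_space (stage A)"
    using compact_Hausdorff by (simp add: stage_def Hausdorff_space_subtopology)
qed

lemma continuous_map_to_stage: "closed_set A \<Longrightarrow> continuous_map X (stage A) (R A)"
  using cont by (auto simp: stage_def continuous_map_in_subtopology)

lemma continuous_map_stages:
  "closed_set A \<Longrightarrow> continuous_map (stage B) (stage A) (R A)"
  using continuous_map_from_subtopology[OF continuous_map_to_stage]
  by (simp add: stage_def)

lemma continuous_map_from_stage: "continuous_map (stage A) X id"
  by (simp add: stage_def continuous_map_from_subtopology id_def)

lemma inverse_limit_of_stages:
  assumes cl: "\<And>B. B \<in> \<D> \<Longrightarrow> closed_set B" and ne: "\<D> \<noteq> {}"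
    and dir: "\<And>A B. A \<in> \<D> \<Longrightarrow> B \<in> \<D> \<Longrightarrow> \<exists>C\<in>\<D>. A \<union> B \<subseteq> C"
  defines "r \<equiv> {(A, B). A \<in> \<D> \<and> B \<in> \<D> \<and> A \<subseteq> B}"
  shows "inverse_system \<D> r stage (\<lambda>A B. R A)"
    and "is_inverse_limit \<D> r stage (\<lambda>A B. R A) (stage (\<Union>\<D>)) R"
    and "(A, B) \<in> r \<Longrightarrow> R A ` topspace (stage B) = topspace (stage A)"
proof -
  let ?U = "\<Union>\<D>"
  have U: "closed_set ?U" using closed_set_directed_Union[OF cl ne dir] .
  have rD: "A \<in> \<D>" "B \<in> \<D>" "A \<subseteq> B" "closed_set A" "closed_set B" if "(A, B) \<in> r" for A B
    using that cl by (auto simp: r_def)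
  have "partial_order_on \<D> r"
    by (auto simp: partial_order_on_def preorder_on_def r_def refl_on_def trans_def antisym_def)
  moreover have "\<exists>C\<in>\<D>. (A, C) \<in> r \<and> (B, C) \<in> r" if "A \<in> \<D>" "B \<in> \<D>" for A B
    using dir[OF that] that by (auto simp: r_def)
  ultimately have "directed_poset \<D> r"
    using ne by (auto simp: directed_poset_def)
  moreover have "\<forall>(A, B)\<in>r. continuous_map (stage B) (stage A) (R A)"
    using rD(4) continuous_map_stages by blast
  moreover have "\<forall>A\<in>\<D>. \<forall>x\<in>topspace (stage A). R A x = x"
    using cl stage_fixed by blast
  moreover have "\<forall>A B C. (A, B) \<in> r \<and> (B, C) \<in> r \<longrightarrow> (\<forall>x\<in>topspace (stage C). R A (R B x) = R A x)"
    using rD R_subset stage_fixed by metis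
  ultimately show "inverse_system \<D> r stage (\<lambda>A B. R A)"
    unfolding inverse_system_def by blast
  show "R A ` topspace (stage B) = topspace (stage A)" if "(A, B) \<in> r"
  proof -
    have "R A ` topspace (stage B) = (\<lambda>x. R A (R B x)) ` topspace X"
      using rD[OF that] by (simp add: topspace_stage image_image)
    also have "\<dots> = R A ` topspace X"
      using rD[OF that] R_subset by (intro image_cong) auto
    finally show ?thesis using rD[OF that] by (simp add: topspace_stage)
  qed
  show "is_inverse_limit \<D> r stage (\<lambda>A B. R A) (stage ?U) R"
  proof (rule is_inverse_limitI)
    show "compact_space (stage ?U)" using compact_Hausdorff_stage[OF U] by blast
    show "Hausdorff_space (stage A)" if "A \<in> \<D>" for A using compact_Hausdorff_stage cl that by blast
    show "r \<subseteq> \<D> \<times> \<D>" by (auto simp: r_def)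
    show "continuous_map (stage ?U) (stage A) (R A)" if "A \<in> \<D>" for A
      using continuous_map_stages cl that by blast
    show "R A (R B x) = R A x" if "x \<in> topspace (stage ?U)" "(A, B) \<in> r" for x A B
      using that rD R_subset stage_fixed[OF U] by metis
    show "x = y" if xy: "x \<in> topspace (stage ?U)" "y \<in> topspace (stage ?U)"
      and eq: "\<And>B. B \<in> \<D> \<Longrightarrow> R B x = R B y" for x y
      using R_Union[OF cl ne dir _ _ eq] xy stage_fixed[OF U] by metis
    fix z assume z: "\<And>B. B \<in> \<D> \<Longrightarrow> z B \<in> topspace (stage B)"
      and thr: "\<And>A B. (A, B) \<in> r \<Longrightarrow> R A (z B) = z A"
    have "\<exists>c\<in>topspace X. \<forall>B\<in>\<D>. R B c = z B"
    proof (rule thread_in_closed_set[OF cl ne dir])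
      show "z B \<in> topspace X" if "B \<in> \<D>" for B using z[OF that] cl[OF that] stage_fixed by blast
      show "R A (z B) = z A" if "A \<in> \<D>" "B \<in> \<D>" "A \<subseteq> B" for A B
        using thr that by (simp add: r_def)
    qed auto
    then obtain c where c: "c \<in> topspace X" "\<And>B. B \<in> \<D> \<Longrightarrow> R B c = z B" by blast
    \<comment> \<open>The point \<open>c\<close> realizes the thread but may lie outside the limit
      stage; retracting it by \<open>R ?U\<close> leaves all its coordinates unchanged.\<close>
    have "R B (R ?U c) = z B" if "B \<in> \<D>" for B
      using R_subset[of B ?U c] c cl[OF that] U that by auto
    moreover have "R ?U c \<in> topspace (stage ?U)" using c U by (simp add: topspace_stage)
    ultimately show "\<exists>x\<in>topspace (stage ?U). \<forall>B\<in>\<D>. R B x = z B" by blast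
  qed
qed

lemma countable_base_stage:
  assumes B: "closed_set B" "countable B"
  shows "\<exists>\<B>. countable \<B> \<and> open_base (stage B) \<B>"
proof -
  obtain \<Phi> where \<Phi>: "countable \<Phi>" "\<forall>f\<in>\<Phi>. continuous_map X euclideanreal f"
    "\<forall>x\<in>topspace X. \<forall>y\<in>topspace X. R B x \<noteq> R B y \<longrightarrow> (\<exists>f\<in>\<Phi>. f x \<noteq> f y)"
    using countable_separating[OF B] by blast
  show ?thesis
  proof (rule countable_base_of_separating[OF _ \<Phi>(1)])
    show "compact_space (stage B)" using compact_Hausdorff_stage[OF B(1)] by blast
    show "continuous_map (stage B) euclideanreal f" if "f \<in> \<Phi>" for f
      using \<Phi>(2) that by (simp add: stage_def continuous_map_from_subtopology)
    show "\<exists>f\<in>\<Phi>. f x \<noteq> f y" if "x \<in> topspace (stage B)" "y \<in> topspace (stage B)" "x \<noteq> y" for x y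
      using that \<Phi>(3) stage_fixed[OF B(1)] by metis
  qed
qed

lemma functor_image:
  fixes Fo :: "'a topology \<Rightarrow> 'b topology"
  assumes F: "compact_functor Fo Fm" and cF: "continuous_functor Fo Fm" and wF: "weight_preserving Fo"
  shows "retraction_system T Op (Fo X) (\<lambda>A. Fm X X (R A))"
proof
  note Fobj = compact_functorD(1)[OF F] and Fcont = compact_functorD(2)[OF F]
    and Fcomp = compact_functorD(3)[OF F] and X = compact_Hausdorff and K = compact_Hausdorff_stage
  show "compact_Hausdorff (Fo X)" using Fobj[OF X] .
  show "continuous_map (Fo X) (Fo X) (Fm X X (R A))" if "closed_set A" for A
    using Fcont[OF X X cont[OF that]] .
  show "Fm X X (R A) (Fm X X (R B) a) = Fm X X (R (A \<inter> B)) a"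
    if "closed_set A" "closed_set B" "a \<in> topspace (Fo X)" for A B a
    using that by (intro Fcomp[OF X X X] cont closed_set_Int R_R)
  show "Fm X X (R T) a = a" if a: "a \<in> topspace (Fo X)" for a
  proof -
    have "Fm X X (R T) (Fm X X id a) = Fm X X id a"
      using a R_T cont[OF closed_set_T] by (intro Fcomp[OF X X X]) auto
    moreover have "Fm X X id a = a"
      using F X a unfolding compact_functor_def by blast
    ultimately show ?thesis by simp
  qed
  \<comment> \<open>With \<open>factor'\<close>, this shows that \<open>Fm X X (R A)\<close> and the
    map into \<open>Fo (stage A)\<close> identify the same points, so agreement can be tested in
    either space.\<close>
  have factor: "Fm (stage A) X id (Fm X (stage A) (R A) a) = Fm X X (R A) a"
    if "closed_set A" "a \<in> topspace (Fo X)" for A a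
    using that by (intro Fcomp[OF X K X] continuous_map_to_stage continuous_map_from_stage cont) auto
  have factor': "Fm X (stage A) (R A) (Fm X X (R A) a) = Fm X (stage A) (R A) a"
    if "closed_set A" "a \<in> topspace (Fo X)" for A a
    using that by (intro Fcomp[OF X X K] continuous_map_to_stage cont R_idem)
  have factor'': "Fm (stage B) (stage A) (R A) (Fm X (stage B) (R B) a) = Fm X (stage A) (R A) a"
    if "closed_set A" "closed_set B" "A \<subseteq> B" "a \<in> topspace (Fo X)" for A B a
    using that by (intro Fcomp[OF X K K] continuous_map_to_stage continuous_map_stages R_subset)
  show "Fm X X (R (\<Union>\<D>)) a = Fm X X (R (\<Union>\<D>)) b"
    if cl: "\<And>B. B \<in> \<D> \<Longrightarrow> closed_set B" and ne: "\<D> \<noteq> {}"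
      and dir: "\<And>A B. A \<in> \<D> \<Longrightarrow> B \<in> \<D> \<Longrightarrow> \<exists>C\<in>\<D>. A \<union> B \<subseteq> C"
      and a: "a \<in> topspace (Fo X)" and b: "b \<in> topspace (Fo X)"
      and eq: "\<And>B. B \<in> \<D> \<Longrightarrow> Fm X X (R B) a = Fm X X (R B) b" for \<D> a b
  proof -
    let ?U = "\<Union>\<D>" and ?r = "{(A, B). A \<in> \<D> \<and> B \<in> \<D> \<and> A \<subseteq> B}"
    have U: "closed_set ?U" using closed_set_directed_Union[OF cl ne dir] .
    note lim = inverse_limit_of_stages[of \<D>, OF cl ne dir]
    have surj: "\<forall>(A, B)\<in>?r. R A ` topspace (stage B) = topspace (stage A)"
      using lim(3) by blast
    have comp: "\<forall>A\<in>\<D>. compact_Hausdorff (stage A)" using K cl by blast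
    have limF: "is_inverse_limit \<D> ?r (\<lambda>A. Fo (stage A)) (\<lambda>A B. Fm (stage B) (stage A) (R A))
        (Fo (stage ?U)) (\<lambda>A. Fm (stage ?U) (stage A) (R A))"
      \<comment> \<open>The system is indexed by subsets of \<open>T\<close>, while
        \<open>continuous_functor\<close> refers to one fixed index type.\<close>
      using continuous_functor_any_index[OF F cF, where 'i="'t set", unfolded preserves_limits_over_def,
          THEN spec[where x=\<D>], THEN spec[where x="?r"], THEN spec[where x=stage],
          THEN spec[where x="\<lambda>A B. R A"], THEN spec[where x="stage ?U"], THEN spec[where x=R], THEN mp,
          OF conjI[OF lim(1) conjI[OF comp conjI[OF surj conjI[OF K[OF U] lim(2)]]]]] .
    have "Fm X (stage ?U) (R ?U) a = Fm X (stage ?U) (R ?U) b"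
    proof (rule is_inverse_limitD(3)[OF limF])
      show "Fm X (stage ?U) (R ?U) a \<in> topspace (Fo (stage ?U))"
        "Fm X (stage ?U) (R ?U) b \<in> topspace (Fo (stage ?U))"
        using Fcont[OF X K[OF U] continuous_map_to_stage[OF U]] a b by (auto simp: continuous_map_def)
      fix B assume B: "B \<in> \<D>"
      then have BU: "B \<subseteq> ?U" by blast
      show "Fm (stage ?U) (stage B) (R B) (Fm X (stage ?U) (R ?U) a) =
          Fm (stage ?U) (stage B) (R B) (Fm X (stage ?U) (R ?U) b)"
        using factor''[OF cl[OF B] U BU a] factor''[OF cl[OF B] U BU b]
          factor'[OF cl[OF B] a] factor'[OF cl[OF B] b] eq[OF B] by simp
    qed
    then show ?thesis using factor[OF U a] factor[OF U b] by simp
  qed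
  show "\<exists>\<Phi>. countable \<Phi> \<and> (\<forall>f\<in>\<Phi>. continuous_map (Fo X) euclideanreal f) \<and>
      (\<forall>a\<in>topspace (Fo X). \<forall>b\<in>topspace (Fo X). Fm X X (R B) a \<noteq> Fm X X (R B) b \<longrightarrow> (\<exists>f\<in>\<Phi>. f a \<noteq> f b))"
    if B: "closed_set B" "countable B" for B
  proof -
    note KB = K[OF B(1)] and cB = continuous_map_to_stage[OF B(1)]
    obtain \<B> where \<B>: "countable \<B>" "open_base (stage B) \<B>"
      using countable_base_stage[OF B] by blast
    \<comment> \<open>A base realizing the weight of \<open>Fo (stage B)\<close> is countable,
      because its size is bounded by the weight of \<open>stage B\<close>.\<close>
    obtain \<B>' where \<B>': "open_base (Fo (stage B)) \<B>'" "weight (Fo (stage B)) = |\<B>'|"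
      using weight_least by blast
    have "|\<B>'| \<le>o weight (stage B)"
      using wF KB \<B>'(2) unfolding weight_preserving_def by metis
    moreover have "weight (stage B) \<le>o |\<B>|"
      using weight_least[of "stage B"] \<B>(2) by metis
    ultimately have "|\<B>'| \<le>o |\<B>|" by (rule ordLeq_transitive)
    then have ctb: "countable \<B>'"
      using \<B>(1) by (meson countable_card_of_nat ordLeq_transitive)
    obtain \<Phi> where \<Phi>: "countable \<Phi>" "\<forall>f\<in>\<Phi>. continuous_map (Fo (stage B)) euclideanreal f"
      "\<forall>x\<in>topspace (Fo (stage B)). \<forall>y\<in>topspace (Fo (stage B)). x \<noteq> y \<longrightarrow> (\<exists>f\<in>\<Phi>. f x \<noteq> f y)"
      using separating_of_countable_base[OF Fobj[OF KB] ctb \<B>'(1)] by (elim exE conjE that)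
    let ?p = "Fm X (stage B) (R B)"
    have p: "continuous_map (Fo X) (Fo (stage B)) ?p" using Fcont[OF X KB cB] .
    show ?thesis
    proof (intro exI[of _ "(\<lambda>f. f \<circ> ?p) ` \<Phi>"] conjI ballI impI)
      show "countable ((\<lambda>f. f \<circ> ?p) ` \<Phi>)" using \<Phi>(1) by blast
      show "continuous_map (Fo X) euclideanreal g" if "g \<in> (\<lambda>f. f \<circ> ?p) ` \<Phi>" for g
        using that \<Phi>(2) by (auto intro: continuous_map_compose[OF p])
      fix a b assume ab: "a \<in> topspace (Fo X)" "b \<in> topspace (Fo X)" "Fm X X (R B) a \<noteq> Fm X X (R B) b"
      then have "?p a \<noteq> ?p b" using factor[OF B(1)] by metis
      moreover have "?p a \<in> topspace (Fo (stage B))" "?p b \<in> topspace (Fo (stage B))"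
        using p ab by (auto simp: continuous_map_def)
      ultimately show "\<exists>g\<in>(\<lambda>f. f \<circ> ?p) ` \<Phi>. g a \<noteq> g b" using \<Phi>(3) by (auto simp: o_def)
    qed
  qed
qed

end

section \<open>Retractions of a Valdivia compact space\<close>

lemma openin_cube_box:
  assumes "finite F" "\<And>t. t \<in> F \<Longrightarrow> open (V t)"
  shows "openin (cube T) {z \<in> topspace (cube T). \<forall>t\<in>F \<inter> T. z t \<in> V t}"
proof -
  have "openin (cube T) (\<Pi>\<^sub>E t\<in>T. if t \<in> F then {0..1} \<inter> V t else {0..1})"
    unfolding cube_def
  proof (rule product_topology_basis)
    show "openin (top_of_set {0..1}) (if t \<in> F then {0..1} \<inter> V t else {0..1})" for t
      using assms(2)[of t] by (auto intro: openin_open_Int)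
    show "finite {t. (if t \<in> F then {0..1} \<inter> V t else {0..1}) \<noteq> topspace (top_of_set {0..1})}"
      by (rule finite_subset[OF _ assms(1)]) auto
  qed
  also have "(\<Pi>\<^sub>E t\<in>T. if t \<in> F then {0..1} \<inter> V t else {0..1}) =
      {z \<in> topspace (cube T). \<forall>t\<in>F \<inter> T. z t \<in> V t}"
    by (auto simp: topspace_cube PiE_iff extensional_def split: if_splits)
  finally show ?thesis .
qed

lemma cube_nbhd:
  assumes U: "openin (cube T) U" "y \<in> U"
  obtains F \<epsilon> where "finite F" "F \<subseteq> T" "\<epsilon> > 0"
    "\<And>z. z \<in> topspace (cube T) \<Longrightarrow> (\<And>t. t \<in> F \<Longrightarrow> \<bar>z t - y t\<bar> < \<epsilon>) \<Longrightarrow> z \<in> U"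
proof -
  obtain V where V: "finite {t \<in> T. V t \<noteq> {0..1}}" "\<And>t. t \<in> T \<Longrightarrow> openin (top_of_set {0..1}) (V t)"
    "y \<in> Pi\<^sub>E T V" "Pi\<^sub>E T V \<subseteq> U"
    using U unfolding cube_def openin_product_topology_alt by (auto; metis)
  let ?F = "{t \<in> T. V t \<noteq> {0..1::real}}"
  have "\<exists>e>0. \<forall>v\<in>{0..1}. \<bar>v - y t\<bar> < e \<longrightarrow> v \<in> V t" if "t \<in> T" for t
  proof -
    have "y t \<in> V t" using V(3) that by auto
    then show ?thesis using V(2)[OF that]
      by (auto simp: openin_euclidean_subtopology_iff dist_real_def)
  qed
  then obtain e where e: "\<And>t. t \<in> T \<Longrightarrow> e t > 0"
    "\<And>t v. t \<in> T \<Longrightarrow> v \<in> {0..1} \<Longrightarrow> \<bar>v - y t\<bar> < e t \<Longrightarrow> v \<in> V t" by metis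
  define \<epsilon> where "\<epsilon> = Min (insert 1 (e ` ?F))"
  show ?thesis
  proof
    show "finite ?F" "?F \<subseteq> T" using V(1) by auto
    show "\<epsilon> > 0" using V(1) e(1) by (auto simp: \<epsilon>_def)
    have \<epsilon>: "\<epsilon> \<le> e t" if "t \<in> ?F" for t using V(1) that by (auto simp: \<epsilon>_def)
    fix z assume z: "z \<in> topspace (cube T)" "\<And>t. t \<in> ?F \<Longrightarrow> \<bar>z t - y t\<bar> < \<epsilon>"
    have "z t \<in> V t" if t: "t \<in> T" for t
    proof (cases "V t = {0..1}")
      case False
      then have "\<bar>z t - y t\<bar> < e t" using z(2)[of t] \<epsilon>[of t] t by force
      then show ?thesis using e(2)[OF t] z(1) t by (auto simp: topspace_cube PiE_iff)
    qed (use z(1) t in \<open>auto simp: topspace_cube PiE_iff\<close>)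
    then have "z \<in> Pi\<^sub>E T V" using z(1) by (auto simp: topspace_cube PiE_iff)
    then show "z \<in> U" using V(4) by blast
  qed
qed

text \<open>\<^term>\<open>approximant S F q n\<close> is a point of \<open>S\<close> in a basic box with rational centre. If \<open>B\<close>
  contains the support of every such point for \<open>F \<subseteq> B\<close>, the points of \<open>S\<close> supported in \<open>B\<close>
  approximate on \<open>B\<close> every point of \<open>closure S\<close>, so that truncation to \<open>B\<close> preserves \<open>closure S\<close>.\<close>

definition near :: "'t set \<Rightarrow> ('t \<Rightarrow> real) \<Rightarrow> nat \<Rightarrow> ('t \<Rightarrow> real) \<Rightarrow> bool" where
  "near F q n x \<longleftrightarrow> (\<forall>t\<in>F. \<bar>x t - q t\<bar> < 1 / Suc n)"

definition approximant :: "('t \<Rightarrow> real) set \<Rightarrow> 't set \<Rightarrow> ('t \<Rightarrow> real) \<Rightarrow> nat \<Rightarrow> 't \<Rightarrow> real" where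
  "approximant S F q n = (SOME x. x \<in> S \<and> near F q n x)"

definition supports :: "'t set \<Rightarrow> ('t \<Rightarrow> real) set \<Rightarrow> 't set \<Rightarrow> 't set" where
  "supports T S F = (\<Union>q\<in>F \<rightarrow>\<^sub>E \<rat>. \<Union>n\<in>{n. \<exists>x\<in>S. near F q n x}. {t \<in> T. approximant S F q n t \<noteq> 0})"

definition truncate :: "'t set \<Rightarrow> 't set \<Rightarrow> ('t \<Rightarrow> real) \<Rightarrow> 't \<Rightarrow> real" where
  "truncate T B x = (\<lambda>t\<in>T. if t \<in> B then x t else 0)"

lemma approximant:
  assumes "\<exists>x\<in>S. near F q n x"
  shows "approximant S F q n \<in> S" "near F q n (approximant S F q n)"
  using someI_ex[of "\<lambda>x. x \<in> S \<and> near F q n x"] assms by (auto simp: approximant_def)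

text \<open>A finite \<open>F\<close> admits countably many rational centres and radii. Only boxes
  that meet \<open>S\<close> are used, so each chosen point lies in the Sigma-product and has
  countable support.\<close>

lemma countable_closure_supports:
  assumes S: "S \<subseteq> Sigma_prod T"
  shows "countable_closure T (supports T S)"
proof
  fix F assume F: "finite F" "F \<subseteq> T"
  show "supports T S F \<subseteq> T" by (auto simp: supports_def)
  show "countable (supports T S F)"
    unfolding supports_def
  proof (intro countable_UN)
    show "countable (F \<rightarrow>\<^sub>E (\<rat> :: real set))" using F countable_rat by (intro countable_PiE) auto
    show "countable {t \<in> T. approximant S F q n t \<noteq> 0}" if "n \<in> {n. \<exists>x\<in>S. near F q n x}" for q n
      using approximant(1)[of S F q n] that S by (auto simp: Sigma_prod_def)
  qed auto
qed

lemma truncate_closure: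
  assumes S: "S \<subseteq> Sigma_prod T" and x: "x \<in> cube T closure_of S"
    and B: "countable_closure.closed_set T (supports T S) B"
  shows "truncate T B x \<in> cube T closure_of S"
proof -
  interpret countable_closure T "supports T S" by (rule countable_closure_supports[OF S])
  have xT: "x \<in> topspace (cube T)" using x by (metis closure_of_subset_topspace subsetD)
  have ST: "S \<subseteq> topspace (cube T)" using S by (auto simp: Sigma_prod_def)
  have "\<exists>z. z \<in> S \<and> z \<in> U" if U: "openin (cube T) U" "truncate T B x \<in> U" for U
  proof -
    obtain F' \<epsilon> where F': "finite F'" "F' \<subseteq> T" and \<epsilon>: "\<epsilon> > 0"
      and nbhd: "\<And>z. z \<in> topspace (cube T) \<Longrightarrow>
        (\<And>t. t \<in> F' \<Longrightarrow> \<bar>z t - truncate T B x t\<bar> < \<epsilon>) \<Longrightarrow> z \<in> U"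
      using cube_nbhd[OF U] by metis
    \<comment> \<open>Only the coordinates in \<open>B\<close> need approximating: elsewhere the
      truncated point is 0, and so is the approximant, whose support lies in
      \<open>B\<close>.\<close>
    define F where "F = F' \<inter> B"
    have F: "finite F" "F \<subseteq> B" "F \<subseteq> T" using F' by (auto simp: F_def)
    \<comment> \<open>Error budget: a point of \<open>S\<close> within \<open>\<delta>\<close> of
      \<open>x\<close> is within \<open>2 * \<delta> = 1 / Suc n\<close> of the rational centre, so
      the box meets \<open>S\<close>. The approximant is then within
      \<open>1 / Suc n + \<delta>\<close> of \<open>x\<close>, which is below
      \<open>\<epsilon>\<close>.\<close>
    obtain n where n: "1 / Suc n < \<epsilon> / 2" using \<epsilon> nat_approx_posE[of "\<epsilon> / 2"] by auto
    define \<delta> where "\<delta> = 1 / (2 * real (Suc n))"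
    have \<delta>: "\<delta> > 0" "\<delta> + \<delta> = 1 / Suc n" by (auto simp: \<delta>_def field_simps)
    have "\<exists>c\<in>\<rat>. \<bar>c - x t\<bar> < \<delta>" for t
      using Rats_dense_in_real[of "x t - \<delta>" "x t + \<delta>"] \<delta>(1) by (force simp: abs_less_iff)
    then obtain c where c: "\<And>t. c t \<in> \<rat>" "\<And>t. \<bar>c t - x t\<bar> < \<delta>" by metis
    define q where "q = restrict c F"
    have "openin (cube T) {z \<in> topspace (cube T). \<forall>t\<in>F \<inter> T. z t \<in> ball (x t) \<delta>}"
      by (rule openin_cube_box) (use F in auto)
    moreover have "x \<in> {z \<in> topspace (cube T). \<forall>t\<in>F \<inter> T. z t \<in> ball (x t) \<delta>}"
      using xT \<delta> by simp
    ultimately obtain w where w: "w \<in> S" "\<forall>t\<in>F \<inter> T. w t \<in> ball (x t) \<delta>"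
      using x unfolding in_closure_of by (metis (no_types, lifting) mem_Collect_eq)
    have "near F q n w"
      unfolding near_def
    proof
      fix t assume t: "t \<in> F"
      then have "\<bar>x t - w t\<bar> < \<delta>" using w(2) F by (auto simp: dist_real_def)
      then show "\<bar>w t - q t\<bar> < 1 / Suc n" using c(2)[of t] \<delta> t by (auto simp: q_def)
    qed
    then have ex: "\<exists>x\<in>S. near F q n x" using w by blast
    let ?z = "approximant S F q n"
    have z: "?z \<in> S" "near F q n ?z" using approximant[OF ex] .
    have "q \<in> F \<rightarrow>\<^sub>E \<rat>" using c(1) by (simp add: q_def)
    then have "{t \<in> T. ?z t \<noteq> 0} \<subseteq> supports T S F"
      unfolding supports_def using ex by blast
    also have "\<dots> \<subseteq> B" using B F by (simp add: closed_set_def)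
    finally have supp: "{t \<in> T. ?z t \<noteq> 0} \<subseteq> B" .
    have "?z \<in> U"
    proof (rule nbhd)
      show "?z \<in> topspace (cube T)" using z ST by blast
      fix t assume t: "t \<in> F'"
      show "\<bar>?z t - truncate T B x t\<bar> < \<epsilon>"
      proof (cases "t \<in> B")
        case True
        then have "t \<in> F" using t by (simp add: F_def)
        then have "\<bar>?z t - c t\<bar> < 1 / Suc n" using z(2) by (auto simp: near_def q_def)
        then have "\<bar>?z t - x t\<bar> < \<epsilon>" using c(2)[of t] \<delta> n by linarith
        then show ?thesis using True t F' by (auto simp: truncate_def)
      next
        case False
        then have "?z t = 0" using supp t F' by blast
        then show ?thesis using False t F' \<epsilon> by (auto simp: truncate_def)
      qed
    qed
    then show ?thesis using z by blast
  qed
  moreover have "truncate T B x \<in> topspace (cube T)"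
    using xT by (auto simp: truncate_def topspace_cube PiE_iff)
  ultimately show ?thesis unfolding in_closure_of by blast
qed

lemma truncate_truncate: "truncate T A (truncate T B x) = truncate T (A \<inter> B) x"
  by (auto simp: truncate_def)

lemma continuous_map_truncate: "continuous_map (cube T) (cube T) (truncate T B)"
  unfolding cube_def continuous_map_componentwise
proof (intro conjI ballI)
  show "truncate T B ` topspace (product_topology (\<lambda>_. top_of_set {0..1}) T) \<subseteq> extensional T"
    by (auto simp: truncate_def)
  fix t assume t: "t \<in> T"
  show "continuous_map (product_topology (\<lambda>_. top_of_set {0..1}) T) (top_of_set {0..1}) (\<lambda>x. truncate T B x t)"
    using t continuous_map_product_projection[OF t, of "\<lambda>_. top_of_set {0..1::real}"]
    by (cases "t \<in> B") (simp_all add: truncate_def)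
qed

text \<open>Truncations of the cube are pulled back along \<open>h\<close>. This is possible for
  closed index sets because the image of \<open>h\<close> is the closure of its points of countable
  support, which such truncations preserve.\<close>

lemma valdivia_retraction_system:
  assumes X: "compact_Hausdorff X" and h: "valdivia_embedding X T h"
  shows "\<exists>Op R. retraction_system T Op X R"
proof -
  define S where "S = Sigma_prod T \<inter> h ` topspace X"
  have S: "S \<subseteq> Sigma_prod T" by (simp add: S_def)
  have emb: "embedding_map X (cube T) h" and dense: "h ` topspace X = cube T closure_of S"
    using h by (auto simp: valdivia_embedding_def S_def)
  then obtain g where g: "homeomorphic_maps X (subtopology (cube T) (h ` topspace X)) h g"
    unfolding embedding_map_def homeomorphic_map_maps by blast
  have conth: "continuous_map X (cube T) h"
    and contg: "continuous_map (subtopology (cube T) (h ` topspace X)) X g"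
    and gh: "\<And>x. x \<in> topspace X \<Longrightarrow> g (h x) = x"
    using g by (auto simp: homeomorphic_maps_def continuous_map_in_subtopology)
  have hT: "h x \<in> topspace (cube T)" if "x \<in> topspace X" for x
    using conth that by (auto simp: continuous_map_def)
  define R where "R B x = g (truncate T B (h x))" for B x
  interpret countable_closure T "supports T S" by (rule countable_closure_supports[OF S])
  have trunc: "truncate T B (h x) \<in> h ` topspace X" if "closed_set B" "x \<in> topspace X" for B x
    using truncate_closure[OF S _ that(1)] that(2) dense by blast
  have hR: "h (R B x) = truncate T B (h x)" and RX: "R B x \<in> topspace X"
    if B: "closed_set B" "x \<in> topspace X" for B x
    using trunc[OF that] gh by (auto simp: R_def)
  have inj: "x = y" if "x \<in> topspace X" "y \<in> topspace X" "h x = h y" for x y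
    using gh that by metis
  have "retraction_system T (supports T S) X R"
  proof
    show "compact_Hausdorff X" using X .
    show "continuous_map X X (R A)" if A: "closed_set A" for A
    proof -
      have "continuous_map X (subtopology (cube T) (h ` topspace X)) (truncate T A \<circ> h)"
        using continuous_map_compose[OF conth continuous_map_truncate] trunc[OF A]
        by (auto simp: continuous_map_in_subtopology)
      from continuous_map_compose[OF this contg] show ?thesis by (simp add: o_def R_def[abs_def])
    qed
    show "R A (R B x) = R (A \<inter> B) x" if "closed_set A" "closed_set B" "x \<in> topspace X" for A B x
      using hR[OF that(2,3)] by (simp add: R_def truncate_truncate)
    show "R T x = x" if x: "x \<in> topspace X" for x
    proof -
      have "truncate T T (h x) = h x"
        using hT[OF x] by (auto simp: truncate_def topspace_cube PiE_iff extensional_def)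
      then show ?thesis using gh x by (simp add: R_def)
    qed
    show "R (\<Union>\<D>) x = R (\<Union>\<D>) y"
      if "\<And>B. B \<in> \<D> \<Longrightarrow> closed_set B" "x \<in> topspace X" "y \<in> topspace X"
        and eq: "\<And>B. B \<in> \<D> \<Longrightarrow> R B x = R B y" for \<D> x y
    proof -
      have "h x t = h y t" if "B \<in> \<D>" "t \<in> B" "t \<in> T" for B t
      proof -
        have "truncate T B (h x) = truncate T B (h y)"
          using hR \<open>B \<in> \<D>\<close> that(1) eq
          by (metis \<open>\<And>B. B \<in> \<D> \<Longrightarrow> closed_set B\<close> \<open>x \<in> topspace X\<close> \<open>y \<in> topspace X\<close>)
        from fun_cong[OF this, of t] show ?thesis using that by (simp add: truncate_def)
      qed
      then have "truncate T (\<Union>\<D>) (h x) = truncate T (\<Union>\<D>) (h y)"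
        by (auto simp: truncate_def intro!: restrict_ext)
      then show ?thesis by (simp add: R_def)
    qed
    show "\<exists>\<Phi>. countable \<Phi> \<and> (\<forall>f\<in>\<Phi>. continuous_map X euclideanreal f) \<and>
        (\<forall>x\<in>topspace X. \<forall>y\<in>topspace X. R B x \<noteq> R B y \<longrightarrow> (\<exists>f\<in>\<Phi>. f x \<noteq> f y))"
      if B: "closed_set B" "countable B" for B
    proof (intro exI[of _ "(\<lambda>t x. h x t) ` B"] conjI ballI impI)
      show "countable ((\<lambda>t x. h x t) ` B)" using B by blast
      show "continuous_map X euclideanreal f" if "f \<in> (\<lambda>t x. h x t) ` B" for f
        using that conth closed_set_subset[OF B(1)]
        by (auto simp: cube_def continuous_map_componentwise continuous_map_in_subtopology)
      fix x y assume "R B x \<noteq> R B y"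
      then have "truncate T B (h x) \<noteq> truncate T B (h y)" by (auto simp: R_def)
      then show "\<exists>f\<in>(\<lambda>t x. h x t) ` B. f x \<noteq> f y"
        unfolding truncate_def bex_simps by (metis (mono_tags, lifting) restrict_ext)
    qed
  qed
  then show ?thesis by blast
qed

theorem corollary6p2:
  fixes Fo :: "'a topology \<Rightarrow> 'b topology"
    and Fm :: "'a topology \<Rightarrow> 'a topology \<Rightarrow> ('a \<Rightarrow> 'a) \<Rightarrow> 'b \<Rightarrow> 'b"
    and K :: "'a topology"
  assumes "compact_functor Fo Fm"
    and "continuous_functor Fo Fm"
    and "weight_preserving Fo"
    and "valdivia_compact K"
  shows "valdivia_compact (Fo K)"
proof -
  obtain T :: "('a \<Rightarrow> real) set" and h where "compact_Hausdorff K" "valdivia_embedding K T h"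
    using assms(4) by (auto simp: valdivia_compact_def)
  then obtain Op R where "retraction_system T Op K R"
    using valdivia_retraction_system by blast
  then interpret retraction_system T Op K R .
  \<comment> \<open>Only the space and the retractions change; the closed subsets of
    \<open>T\<close> and their cardinalities are those found for \<open>K\<close>.\<close>
  interpret image: retraction_system T Op "Fo K" "\<lambda>A. Fm K K (R A)"
    by (rule functor_image[OF assms(1-3)])
  show ?thesis by (rule image.valdivia_compact)
qed

end
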